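(* Let $N\ge1$ and $s\in(0,1)$. Then $$[u]_{W^{s,1}(\mathbb R^N)}\ge \mathfrak h_{s,1}(\mathbb R^N\setminus\{0\})\int_{\mathbb R^N}\frac{|u(x)|}{|x|^s}\,dx$$ for all $u\in\mathcal W^{s,1}_0(\mathbb R^N)$, with sharp constant given by $$\mathfrak h_{s,1}(\mathbb R^N\setminus\{0\})=\frac4s\,\frac{\pi^{\frac N2}\,\Gamma(1-s)}{\Gamma\left(\frac{N-s}2\right)\Gamma\left(1-\frac s2\right)}.$$ Equality holds in the inequality $[u]_{W^{s,1}(\mathbb R^N)}\ge \mathfrak h_{s,1}(\mathbb R^N\setminus\{0\})\int_{\mathbb R^N}\frac{|u(x)|}{|x|^s}\,dx$ if and only if $u$ is proportional to a symmetric decreasing function.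
   Context: For a non-empty open set $\Omega\subsetneq\mathbb R^N$ and $x\in\Omega$, $d_\Omega(x)=\inf_{y\in\partial\Omega}|x-y|$ (so $d_{\mathbb R^N\setminus\{0\}}(x)=|x|$). $C^\infty_0(\Omega)$ is the set of smooth real functions on $\mathbb R^N$ with compact support contained in $\Omega$. For $s\in(0,1)$ and measurable $u$ on $\mathbb R^N$, $$[u]_{W^{s,1}(\mathbb R^N)}=\int_{\mathbb R^N}\int_{\mathbb R^N}\frac{|u(x)-u(y)|}{|x-y|^{N+s}}\,dx\,dy,$$ $$\mathfrak h_{s,1}(\Omega)=\inf_{u\in C^\infty_0(\Omega)}\Big\{[u]_{W^{s,1}(\mathbb R^N)}:\int_\Omega\frac{|u|}{d_\Omega^s}\,dx=1\Big\}.$$ $\mathcal W^{s,1}_0(\mathbb R^N)$ is the completion of $C_0^\infty(\mathbb R^N)$ with respect to $[\cdot]_{W^{s,1}(\mathbb R^N)}$, identified with $\{u\in L^{N/(N-s)}(\mathbb R^N):[u]_{W^{s,1}(\mathbb R^N)}<\infty\}$. $\Gamma$ is the Gamma function. A symmetric decreasing function is a non-negative, radially symmetric function that is non-increasing in $|x|$ (functions being understood up to a.e. equality). *)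

theory Defs
  imports "HOL-Analysis.Analysis"
begin

text \<open>Points of \<open>\<real>\<^sup>N\<close> range over a Euclidean space \<open>'a\<close>, with \<open>N = DIM('a)\<close>. Integrals of
  non-negative functions are taken in \<open>[0,\<infinity>]\<close>, so that seminorms and infima need no finiteness
  side conditions.\<close>

definition boundary_dist :: "'a::euclidean_space set \<Rightarrow> 'a \<Rightarrow> real" where
  "boundary_dist \<Omega> x = infdist x (frontier \<Omega>)"

text \<open>A function is \<open>C\<^sup>k\<^sup>+\<^sup>1\<close> on the whole space iff it is differentiable everywhere and its partial
  derivatives are \<open>C\<^sup>k\<close>.\<close>

primrec Ck :: "nat \<Rightarrow> ('a::euclidean_space \<Rightarrow> real) \<Rightarrow> bool" where
  "Ck 0 f \<longleftrightarrow> continuous_on UNIV f"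
| "Ck (Suc k) f \<longleftrightarrow> f differentiable_on UNIV \<and>
     (\<forall>b\<in>Basis. Ck k (\<lambda>x. frechet_derivative f (at x) b))"

definition smooth :: "('a::euclidean_space \<Rightarrow> real) \<Rightarrow> bool" where
  "smooth f \<longleftrightarrow> (\<forall>k. Ck k f)"

definition test_functions :: "'a::euclidean_space set \<Rightarrow> ('a \<Rightarrow> real) set" where
  "test_functions \<Omega> =
     {u. smooth u \<and> compact (closure {x. u x \<noteq> 0}) \<and> closure {x. u x \<noteq> 0} \<subseteq> \<Omega>}"

text \<open>On the null sets \<open>{x = y}\<close> and \<open>{x = 0}\<close> the integrands below have the value \<open>0\<close>, as division
  by zero yields zero.\<close>

definition gagliardo :: "real \<Rightarrow> ('a::euclidean_space \<Rightarrow> real) \<Rightarrow> ennreal" where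
  "gagliardo s u =
     (\<integral>\<^sup>+ y. (\<integral>\<^sup>+ x. ennreal (\<bar>u x - u y\<bar> / norm (x - y) powr (real DIM('a) + s)) \<partial>lebesgue)
        \<partial>lebesgue)"

definition hardy_const :: "real \<Rightarrow> 'a::euclidean_space set \<Rightarrow> ennreal" where
  "hardy_const s \<Omega> =
     Inf {gagliardo s u | u. u \<in> test_functions \<Omega> \<and>
            (\<integral>\<^sup>+ x\<in>\<Omega>. ennreal (\<bar>u x\<bar> / boundary_dist \<Omega> x powr s) \<partial>lebesgue) = 1}"

definition hardy_integral :: "real \<Rightarrow> ('a::euclidean_space \<Rightarrow> real) \<Rightarrow> ennreal" where
  "hardy_integral s u = (\<integral>\<^sup>+ x. ennreal (\<bar>u x\<bar> / norm x powr s) \<partial>lebesgue)"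

text \<open>The completion of the test functions on the whole space with respect to the Gagliardo
  seminorm, in its concrete form as a space of functions in \<open>L\<^sup>q\<close> with \<open>q = N/(N - s)\<close>.
  Its elements are functions rather than classes modulo a.e. equality.\<close>

definition homogeneous_W0 :: "real \<Rightarrow> ('a::euclidean_space \<Rightarrow> real) set" where
  "homogeneous_W0 s =
     {u \<in> borel_measurable lebesgue.
        (\<integral>\<^sup>+ x. ennreal (\<bar>u x\<bar> powr (real DIM('a) / (real DIM('a) - s))) \<partial>lebesgue) < \<infinity> \<and>
        gagliardo s u < \<infinity>}"

text \<open>Monotonicity is not required at the origin: unbounded symmetric decreasing functions such as
  \<open>|x|\<^sup>-\<^sup>a\<close> near \<open>0\<close> would need the value \<open>\<infinity>\<close> there, whereas the functions here are real-valued
  and considered up to a.e. equality.\<close>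

definition symmetric_decreasing :: "('a::euclidean_space \<Rightarrow> real) \<Rightarrow> bool" where
  "symmetric_decreasing g \<longleftrightarrow>
     (\<forall>x. 0 \<le> g x) \<and>
     (\<forall>x y. norm x = norm y \<longrightarrow> g x = g y) \<and>
     (\<forall>x y. x \<noteq> 0 \<and> norm x \<le> norm y \<longrightarrow> g y \<le> g x)"

definition proportional_to_symmetric_decreasing :: "('a::euclidean_space \<Rightarrow> real) \<Rightarrow> bool" where
  "proportional_to_symmetric_decreasing u \<longleftrightarrow>
     (\<exists>(c::real) g. symmetric_decreasing g \<and> (AE x in lebesgue. u x = c * g x))"

end

theory Submission imports Defs begin

text \<open>The inequality comes from a calibration rather than from rearrangement. Write
\<open>K(z) = |z|\<^bsup>-(N+s)\<^esup>\<close>, \<open>H(u) = \<integral> |u| |x|\<^bsup>-s\<^esup>\<close> and \<open>[u]\<close> for the Gagliardo seminorm. By the symmetry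
of the kernel, \<open>[u]\<close> is twice the integral of \<open>|u(x) - u(y)| K(x - y)\<close> over the pairs with
\<open>|x| < |y|\<close>. On such pairs
\<open>|u(x) - u(y)| = |u(x)| - |u(y)| + \<sigma>(x, y)\<close> with \<open>\<sigma>(x, y) \<ge> 0\<close>, where the slack
\<open>\<sigma>\<close> vanishes exactly when \<open>u(y)\<close> lies between \<open>0\<close> and \<open>u(x)\<close>. After integration
against \<open>K\<close>, rotation invariance and homogeneity force the contribution of \<open>|u(x)| - |u(y)|\<close> to be
a universal multiple of \<open>H(u)\<close>. Hence
\<open>[u] = C H(u) + 2 \<integral>\<integral> \<sigma>(x, y) K(x - y)\<close>, with the double integral over \<open>|x| < |y|\<close>,
which is \<open>fractional_hardy_identity\<close>. It contains the inequality, and it shows that equality holds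
exactly when \<open>\<sigma>\<close> vanishes almost everywhere.

The two terms \<open>|u(x)|\<close> and \<open>|u(y)|\<close> have infinite integrals up to the sphere \<open>|x| = |y|\<close>. They are
therefore separated on the region \<open>l |x| < |y|\<close> with \<open>l > 1\<close>
(\<open>ordered_energy_balance\<close>), where both kernel masses are eliminated by comparing \<open>u\<close> with a
Gaussian, which has no slack (\<open>ordered_energy_gaussian_comparison\<close>); then \<open>l\<close> decreases to \<open>1\<close>. The
comparison also computes the constant: \<open>C = [g] / H(g)\<close> for the Gaussian \<open>g\<close>, and \<open>[g]\<close> is explicit
because translating \<open>g\<close> by \<open>q\<close> changes it by the Gaussian measure of a slab of width \<open>|q|\<close>
(\<open>gaussian_increment\<close>). Legendre duplication brings the quotient into the stated form
(\<open>gaussian_quotient\<close>).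

If \<open>\<sigma> = 0\<close> almost everywhere, then \<open>u\<close> has one sign and each superlevel set of \<open>|u|\<close> agrees with a
centred ball up to a null set; the function rebuilt from these balls is symmetric decreasing
(\<open>slack_energy_zero_iff_proportional\<close>).

Finally, \<open>C\<close> is the Hardy constant of the punctured space. Let \<open>w\<close> be a smooth radially
decreasing function, constant near the origin and with compact support. Then \<open>w(x) - w(cx)\<close> is an
admissible function for large \<open>c\<close>, and since the Hardy integral and the seminorm of \<open>w(cx)\<close> are of order
\<open>c\<^bsup>s-N\<^esup>\<close>, its quotient tends to \<open>C\<close> as \<open>c\<close> grows (\<open>hardy_const_punctured_le\<close>).\<close>

section \<open>Invariance of Lebesgue measure and integration of radial functions\<close>

lemma nn_integral_lborel_translate:
  fixes F :: "'a::euclidean_space \<Rightarrow> ennreal"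
  assumes [measurable]: "F \<in> borel_measurable borel"
  shows "(\<integral>\<^sup>+ x. F (x + a) \<partial>lborel) = (\<integral>\<^sup>+ x. F x \<partial>lborel)"
proof -
  have "(\<integral>\<^sup>+ x. F x \<partial>lborel) = (\<integral>\<^sup>+ x. F x \<partial>distr lborel borel ((+) a))"
    by (simp add: lborel_distr_plus)
  also have "\<dots> = (\<integral>\<^sup>+ x. F (a + x) \<partial>lborel)"
    by (rule nn_integral_distr) auto
  finally show ?thesis by (simp add: add.commute)
qed

lemma nn_integral_lborel_dilate:
  fixes F :: "'a::euclidean_space \<Rightarrow> ennreal"
  assumes [measurable]: "F \<in> borel_measurable borel" and "c > 0"
  shows "(\<integral>\<^sup>+ x. F x \<partial>lborel) = ennreal (c ^ DIM('a)) * (\<integral>\<^sup>+ x. F (c *\<^sub>R x) \<partial>lborel)"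
proof -
  have "(\<integral>\<^sup>+ x. F x \<partial>lborel)
      = (\<integral>\<^sup>+ x. F x \<partial>density (distr lborel borel (\<lambda>x. 0 + c *\<^sub>R x)) (\<lambda>_. \<bar>c\<bar>^DIM('a)))"
    using lborel_affine[of c "0::'a"] \<open>c > 0\<close> by simp
  also have "\<dots> = (\<integral>\<^sup>+ x. ennreal (c ^ DIM('a)) * F (c *\<^sub>R x) \<partial>lborel)"
    using \<open>c > 0\<close> by (simp add: nn_integral_density nn_integral_distr)
  also have "\<dots> = ennreal (c ^ DIM('a)) * (\<integral>\<^sup>+ x. F (c *\<^sub>R x) \<partial>lborel)"
    by (rule nn_integral_cmult) simp
  finally show ?thesis .
qed

text \<open>The integral against Lebesgue measure composed with \<open>T\<close> is again translation invariant, and the usual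
Fubini argument for uniqueness of Haar measure compares the two. Testing with the unit ball, which is
invariant under \<open>T\<close> and under reflection in the origin, shows that the proportionality factor is \<open>1\<close>.\<close>

lemma nn_integral_lborel_orthogonal:
  fixes F :: "'a::euclidean_space \<Rightarrow> ennreal" and T :: "'a \<Rightarrow> 'a"
  assumes [measurable]: "F \<in> borel_measurable borel" and T: "orthogonal_transformation T"
  shows "(\<integral>\<^sup>+ x. F (T x) \<partial>lborel) = (\<integral>\<^sup>+ x. F x \<partial>lborel)"
proof -
  let ?g = "indicator (ball 0 1) :: 'a \<Rightarrow> ennreal"
  have [measurable]: "?g \<in> borel_measurable borel"
    by (intro borel_measurable_indicator) simp
  have lin: "linear T" and norm_T: "\<And>x. norm (T x) = norm x"
    using T by (auto simp: orthogonal_transformation)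
  have [measurable]: "T \<in> borel_measurable borel"
    by (intro borel_measurable_continuous_onI linear_continuous_on linear_conv_bounded_linear[THEN iffD1] lin)
  have surjT: "surj T"
    using linear_injective_imp_surjective[OF lin orthogonal_transformation_inj[OF T]] by simp
  have shift: "(\<integral>\<^sup>+ x. G (T x + y) \<partial>lborel) = (\<integral>\<^sup>+ x. G (T x) \<partial>lborel)"
    if [measurable]: "G \<in> borel_measurable borel" for G :: "'a \<Rightarrow> ennreal" and y
  proof -
    obtain z where "y = T z" using surjT by (metis surjD)
    then show ?thesis
      using nn_integral_lborel_translate[of "\<lambda>x. G (T x)" z] by (simp add: linear_add[OF lin])
  qed
  have "(\<integral>\<^sup>+ x. F (T x) \<partial>lborel) * (\<integral>\<^sup>+ y. ?g y \<partial>lborel)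
      = (\<integral>\<^sup>+ y. (\<integral>\<^sup>+ x. F (T x) \<partial>lborel) * ?g y \<partial>lborel)"
    by (subst nn_integral_cmult) auto
  also have "\<dots> = (\<integral>\<^sup>+ y. (\<integral>\<^sup>+ x. F (T x + y) * ?g y \<partial>lborel) \<partial>lborel)"
    by (subst nn_integral_multc) (auto simp: shift)
  also have "\<dots> = (\<integral>\<^sup>+ x. (\<integral>\<^sup>+ y. F (T x + y) * ?g y \<partial>lborel) \<partial>lborel)"
    by (rule lborel_pair.Fubini') simp
  also have "\<dots> = (\<integral>\<^sup>+ x. (\<integral>\<^sup>+ y. F y * ?g (y - T x) \<partial>lborel) \<partial>lborel)"
  proof (rule nn_integral_cong)
    fix x
    show "(\<integral>\<^sup>+ y. F (T x + y) * ?g y \<partial>lborel) = (\<integral>\<^sup>+ y. F y * ?g (y - T x) \<partial>lborel)"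
      using nn_integral_lborel_translate[of "\<lambda>y. F y * ?g (y - T x)" "T x"] by (simp add: add.commute)
  qed
  also have "\<dots> = (\<integral>\<^sup>+ y. (\<integral>\<^sup>+ x. F y * ?g (y - T x) \<partial>lborel) \<partial>lborel)"
    by (rule lborel_pair.Fubini') simp
  also have "\<dots> = (\<integral>\<^sup>+ y. F y * (\<integral>\<^sup>+ x. ?g (y - T x) \<partial>lborel) \<partial>lborel)"
    by (subst nn_integral_cmult) auto
  also have "\<dots> = (\<integral>\<^sup>+ y. F y * (\<integral>\<^sup>+ x. ?g x \<partial>lborel) \<partial>lborel)"
  proof (rule nn_integral_cong, rule arg_cong2[where f="(*)"], rule refl)
    fix y
    have "(\<integral>\<^sup>+ x. ?g (y - T x) \<partial>lborel) = (\<integral>\<^sup>+ x. ?g (T x + - y) \<partial>lborel)"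
      by (intro nn_integral_cong) (auto simp: indicator_def norm_minus_commute)
    also have "\<dots> = (\<integral>\<^sup>+ x. ?g (T x) \<partial>lborel)" by (rule shift) simp
    also have "\<dots> = (\<integral>\<^sup>+ x. ?g x \<partial>lborel)"
      by (intro nn_integral_cong) (auto simp: indicator_def norm_T)
    finally show "(\<integral>\<^sup>+ x. ?g (y - T x) \<partial>lborel) = (\<integral>\<^sup>+ x. ?g x \<partial>lborel)" .
  qed
  also have "\<dots> = (\<integral>\<^sup>+ y. F y \<partial>lborel) * (\<integral>\<^sup>+ x. ?g x \<partial>lborel)"
    by (rule nn_integral_multc) simp
  finally have eq: "(\<integral>\<^sup>+ x. F (T x) \<partial>lborel) * emeasure lborel (ball 0 (1::real) :: 'a set)
      = (\<integral>\<^sup>+ y. F y \<partial>lborel) * emeasure lborel (ball 0 (1::real) :: 'a set)"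
    by simp
  have "unit_ball_vol (real DIM('a)) \<noteq> 0"
    using unit_ball_vol_pos[of "real DIM('a)"] by linarith
  then show ?thesis
    using eq by (simp add: emeasure_ball ennreal_mult_cancel_left mult.commute[of _ "ennreal _"])
qed

text \<open>If \<open>a \<noteq> b\<close>, the reflection in the hyperplane orthogonal to \<open>a - b\<close> exchanges the two.\<close>

lemma orthogonal_transformation_exists_euclidean:
  fixes a b :: "'a::euclidean_space"
  assumes "norm a = norm b"
  obtains T where "orthogonal_transformation T" "T a = b"
proof (cases "a = b")
  case True
  then show ?thesis using that[of "\<lambda>x. x"] by simp
next
  case False
  define w where "w = a - b"
  define T where "T x = x - (2 * (x \<bullet> w) / (w \<bullet> w)) *\<^sub>R w" for x
  have w: "w \<bullet> w \<noteq> 0" using False by (simp add: w_def)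
  have ab: "a \<bullet> a = b \<bullet> b" using assms by (simp add: norm_eq)
  have "linear T"
    by (rule linearI) (simp_all add: T_def inner_add_left add_divide_distrib algebra_simps)
  moreover have "T v \<bullet> T u = v \<bullet> u" for u v
    using w by (simp add: T_def inner_diff_left inner_diff_right inner_commute field_simps)
  ultimately have "orthogonal_transformation T" by (simp add: orthogonal_transformation_def)
  moreover have "2 * (a \<bullet> w) = w \<bullet> w"
    using ab by (simp add: w_def inner_diff_left inner_diff_right inner_commute)
  then have "T a = b" using w by (simp add: T_def w_def)
  ultimately show ?thesis using that by blast
qed

text \<open>Polar coordinates for functions of the norm: the volume \<open>\<omega>\<^sub>N b\<^sup>N\<close> of the ball of radius \<open>b\<close> is the
integral of \<open>N \<omega>\<^sub>N r\<^bsup>N-1\<^esup>\<close> over \<open>[0, b]\<close>, so the image of Lebesgue measure under the norm has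
that density.\<close>

lemma nn_integral_radial:
  fixes F :: "real \<Rightarrow> ennreal"
  assumes [measurable]: "F \<in> borel_measurable borel"
  shows "(\<integral>\<^sup>+ x. F (norm x) \<partial>(lborel :: 'a::euclidean_space measure))
    = ennreal (DIM('a) * unit_ball_vol DIM('a)) * (\<integral>\<^sup>+ r. F r * ennreal (r ^ (DIM('a) - 1)) * indicator {0<..} r \<partial>lborel)"
proof -
  let ?L = "lborel :: 'a measure" and ?n = "DIM('a)"
  let ?w = "\<lambda>r::real. ennreal (?n * unit_ball_vol ?n * r ^ (?n - 1)) * indicator {0<..} r"
  let ?M = "distr ?L borel norm" and ?D = "density lborel ?w"
  have D: "emeasure ?D {..b} = ennreal (unit_ball_vol ?n * b ^ ?n)" if "b \<ge> 0" for b
  proof -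
    have "emeasure ?D {..b} = (\<integral>\<^sup>+ r. ennreal (?n * unit_ball_vol ?n * r ^ (?n - 1)) * indicator {0..b} r \<partial>lborel)"
    proof (subst emeasure_density)
      show "(\<integral>\<^sup>+ r. ?w r * indicator {..b} r \<partial>lborel)
          = (\<integral>\<^sup>+ r. ennreal (?n * unit_ball_vol ?n * r ^ (?n - 1)) * indicator {0..b} r \<partial>lborel)"
        by (rule nn_integral_cong_AE, rule AE_mp[OF AE_lborel_singleton[of "0::real"]], rule AE_I2)
          (auto split: split_indicator)
    qed auto
    also have "\<dots> = ennreal (unit_ball_vol ?n * b ^ ?n - unit_ball_vol ?n * 0 ^ ?n)"
      using that by (intro nn_integral_FTC_Icc) (auto intro!: derivative_eq_intros)
    finally show ?thesis by (simp add: zero_power)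
  qed
  have M: "emeasure ?M {..b} = ennreal (unit_ball_vol ?n * b ^ ?n)" if "b \<ge> 0" for b
  proof -
    have "emeasure ?M {..b} = emeasure ?L (cball 0 b)"
      by (subst emeasure_distr) (auto intro!: arg_cong[where f="emeasure _"])
    with that show ?thesis by (simp add: emeasure_cball)
  qed
  have neg: "emeasure ?D {..b} = 0" "emeasure ?M {..b} = 0" if "b < 0" for b
  proof -
    have "emeasure ?D {..b} = (\<integral>\<^sup>+ (r::real). 0 \<partial>lborel)"
    proof (subst emeasure_density)
      show "(\<integral>\<^sup>+ r. ?w r * indicator {..b} r \<partial>lborel) = (\<integral>\<^sup>+ (r::real). 0 \<partial>lborel)"
        using that by (intro nn_integral_cong) (auto split: split_indicator)
    qed auto
    then show "emeasure ?D {..b} = 0" by simp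
    have "norm -` {..b} \<inter> space lborel = ({} :: 'a set)"
      using that norm_ge_zero by (auto dest: le_less_trans simp: not_le[symmetric] intro: order_trans)
    then show "emeasure ?M {..b} = 0" by (subst emeasure_distr) auto
  qed
  have "?M = ?D"
  proof (rule measure_eqI_generator_eq[where E="range (\<lambda>b::real. {..b})" and \<Omega>=UNIV and A="\<lambda>i. {..real i}"])
    show "Int_stable (range (\<lambda>b::real. {..b}))"
      by (auto simp: Int_stable_def)
    show "emeasure ?M X = emeasure ?D X" if X: "X \<in> range (\<lambda>b::real. {..b})" for X
    proof -
      obtain b where "X = {..b}" using X by auto
      then show ?thesis using D M neg by (cases "b \<ge> 0") auto
    qed
    show "sets ?M = sigma_sets UNIV (range (\<lambda>b::real. {..b}))"
      "sets ?D = sigma_sets UNIV (range (\<lambda>b::real. {..b}))"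
      by (simp_all add: borel_eq_atMost)
    show "(\<Union>i. {..real i}) = UNIV" by (auto intro: real_arch_simple)
    show "emeasure ?M {..real i} \<noteq> \<infinity>" for i by (subst M) auto
  qed auto
  then have "(\<integral>\<^sup>+ x. F (norm x) \<partial>?L) = (\<integral>\<^sup>+ r. F r \<partial>?D)"
    by (subst nn_integral_distr[of norm ?L borel F, symmetric]) auto
  also have "\<dots> = (\<integral>\<^sup>+ r. ennreal (?n * unit_ball_vol ?n) * (F r * ennreal (r ^ (?n - 1)) * indicator {0<..} r) \<partial>lborel)"
    by (subst nn_integral_density)
      (auto intro!: nn_integral_cong simp: ennreal_mult indicator_def mult_ac)
  also have "\<dots> = ennreal (?n * unit_ball_vol ?n) * (\<integral>\<^sup>+ r. F r * ennreal (r ^ (?n - 1)) * indicator {0<..} r \<partial>lborel)"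
    by (rule nn_integral_cmult) simp
  finally show ?thesis .
qed

section \<open>Gamma integrals and radial weights\<close>

lemma nn_integral_atLeast_SUP:
  fixes F :: "real \<Rightarrow> ennreal" and h :: "nat \<Rightarrow> real"
  assumes [measurable]: "F \<in> borel_measurable borel"
    and "incseq h" and unbounded: "\<And>x. \<exists>n. x \<le> h n"
  shows "(\<integral>\<^sup>+ x. F x * indicator {0..} x \<partial>lborel) = (SUP n. \<integral>\<^sup>+ x. F x * indicator {0..h n} x \<partial>lborel)"
proof -
  have *: "F x * indicator {0..} x = (SUP n. F x * indicator {0..h n} x)" for x
  proof (rule antisym)
    obtain n where "x \<le> h n" using unbounded by blast
    then have "F x * indicator {0..} x \<le> F x * indicator {0..h n} x"
      by (auto split: split_indicator)
    then show "F x * indicator {0..} x \<le> (SUP n. F x * indicator {0..h n} x)"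
      by (rule SUP_upper2[OF UNIV_I])
    show "(SUP n. F x * indicator {0..h n} x) \<le> F x * indicator {0..} x"
      by (rule SUP_least) (auto split: split_indicator)
  qed
  show ?thesis unfolding *
  proof (rule nn_integral_monotone_convergence_SUP)
    show "incseq (\<lambda>n x. F x * indicator {0..h n} x)"
      using incseqD[OF \<open>incseq h\<close>]
      by (auto simp: incseq_def le_fun_def split: split_indicator intro: order_trans)
  qed simp
qed

text \<open>The substitution \<open>t = r\<^sup>2\<close> in Euler's integral. It is carried out on \<open>[0, n]\<close>, and monotone
convergence passes to the half-line.\<close>

lemma nn_integral_powr_gaussian:
  fixes p :: real
  assumes "p > -1"
  shows "(\<integral>\<^sup>+ r. ennreal (r powr p * exp (- r\<^sup>2)) * indicator {0<..} r \<partial>lborel) = ennreal (Gamma ((p + 1) / 2) / 2)"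
proof -
  define a where "a = (p + 1) / 2"
  have a: "a > 0" "2 * a - 1 = p" using assms by (auto simp: a_def field_simps)
  let ?F = "\<lambda>t. ennreal (t powr (a - 1) / exp t)"
  have pt: "?F (r\<^sup>2) * ennreal (2 * r) = 2 * ennreal (r powr p * exp (- r\<^sup>2))" if "r \<ge> 0" for r
  proof (cases "r = 0")
    case False
    then have "r > 0" using that by simp
    have "(r\<^sup>2) powr (a - 1) * r = r powr p"
    proof -
      have "(r\<^sup>2) powr (a - 1) * r = (r powr 2) powr (a - 1) * r powr 1"
        using \<open>r > 0\<close> by simp
      also have "\<dots> = r powr (2 * (a - 1) + 1)" by (simp only: powr_powr powr_add)
      also have "2 * (a - 1) + 1 = p" using a by simp
      finally show ?thesis .
    qed
    then have "(r\<^sup>2) powr (a - 1) / exp (r\<^sup>2) * (2 * r) = 2 * (r powr p * exp (- r\<^sup>2))"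
      by (simp add: exp_minus field_simps)
    then show ?thesis
      using \<open>r > 0\<close> by (simp add: ennreal_mult'[symmetric] ennreal_mult[symmetric] numeral_mult_ennreal)
  qed simp
  have "ennreal (Gamma a) = (\<integral>\<^sup>+ t. ?F t * indicator {0..} t \<partial>lborel)"
    using Gamma_conv_nn_integral_real[OF a(1)]
    by (auto intro!: nn_integral_cong split: split_indicator)
  also have "\<dots> = (SUP n. \<integral>\<^sup>+ t. ?F t * indicator {0..(real n)\<^sup>2} t \<partial>lborel)"
  proof (rule nn_integral_atLeast_SUP)
    show "\<exists>n. x \<le> (real n)\<^sup>2" for x
    proof -
      obtain n where "sqrt \<bar>x\<bar> \<le> real n" using real_arch_simple by blast
      then have "\<bar>x\<bar> \<le> (real n)\<^sup>2" by (simp add: real_le_rsqrt real_sqrt_le_iff sqrt_le_D)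
      then show ?thesis by (intro exI[of _ n]) linarith
    qed
    show "incseq (\<lambda>n. (real n)\<^sup>2)" by (auto simp: incseq_def intro!: power_mono)
  qed simp
  also have "\<dots> = (SUP n. \<integral>\<^sup>+ r. (2 * ennreal (r powr p * exp (- r\<^sup>2))) * indicator {0..real n} r \<partial>lborel)"
  proof (rule SUP_cong[OF refl])
    fix n
    show "(\<integral>\<^sup>+ t. ?F t * indicator {0..(real n)\<^sup>2} t \<partial>lborel)
        = (\<integral>\<^sup>+ r. (2 * ennreal (r powr p * exp (- r\<^sup>2))) * indicator {0..real n} r \<partial>lborel)"
    proof (cases "n = 0")
      case True
      have *: "(\<integral>\<^sup>+ x. G x * indicator {0::real} x \<partial>lborel) = 0" for G :: "real \<Rightarrow> ennreal"
      proof -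
        have "AE x in lborel. G x * indicator {0::real} x = 0"
          by (rule AE_mp[OF AE_lborel_singleton[of "0::real"]], rule AE_I2) auto
        then have "(\<integral>\<^sup>+ x. G x * indicator {0::real} x \<partial>lborel) = (\<integral>\<^sup>+ (x::real). 0 \<partial>lborel)"
          by (rule nn_integral_cong_AE)
        then show ?thesis by simp
      qed
      from True show ?thesis by (simp add: *)
    next
      case False
      have "(\<integral>\<^sup>+ t. ?F t * indicator {0\<^sup>2..(real n)\<^sup>2} t \<partial>lborel)
          = (\<integral>\<^sup>+ r. ?F (r\<^sup>2) * ennreal (2 * r) * indicator {0..real n} r \<partial>lborel)"
        using False by (intro nn_integral_substitution_aux[where g'="\<lambda>r. 2 * r"])
          (auto intro!: derivative_eq_intros continuous_intros)
      also have "\<dots> = (\<integral>\<^sup>+ r. (2 * ennreal (r powr p * exp (- r\<^sup>2))) * indicator {0..real n} r \<partial>lborel)"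
        by (intro nn_integral_cong) (auto simp: pt split: split_indicator)
      finally show ?thesis by simp
    qed
  qed
  also have "\<dots> = (\<integral>\<^sup>+ r. (2 * ennreal (r powr p * exp (- r\<^sup>2))) * indicator {0..} r \<partial>lborel)"
    by (rule nn_integral_atLeast_SUP[symmetric])
      (auto simp: incseq_def intro: real_arch_simple)
  also have "\<dots> = 2 * (\<integral>\<^sup>+ r. ennreal (r powr p * exp (- r\<^sup>2)) * indicator {0..} r \<partial>lborel)"
    by (subst nn_integral_cmult[symmetric]) (auto simp: mult_ac)
  also have "(\<integral>\<^sup>+ r. ennreal (r powr p * exp (- r\<^sup>2)) * indicator {0..} r \<partial>lborel)
      = (\<integral>\<^sup>+ r. ennreal (r powr p * exp (- r\<^sup>2)) * indicator {0<..} r \<partial>lborel)"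
    by (rule nn_integral_cong) (auto split: split_indicator)
  finally have *: "2 * (\<integral>\<^sup>+ r. ennreal (r powr p * exp (- r\<^sup>2)) * indicator {0<..} r \<partial>lborel) = ennreal (Gamma a)" by simp
  have "ennreal (Gamma a) = 2 * ennreal (Gamma a / 2)"
    using ennreal_mult'[of 2 "Gamma a / 2"] by simp
  with * show ?thesis
    by (simp add: ennreal_mult_cancel_left a_def)
qed

lemma nn_integral_powr_tail:
  fixes s a :: real
  assumes "s > 0" "a > 0"
  shows "(\<integral>\<^sup>+ r. ennreal (r powr (- 1 - s)) * indicator {a<..} r \<partial>lborel) = ennreal (a powr (- s) / s)"
proof -
  have "(\<integral>\<^sup>+ r. ennreal (r powr (- 1 - s)) * indicator {a<..} r \<partial>lborel)
      = (\<integral>\<^sup>+ r. ennreal (r powr (- 1 - s)) * indicator {a..} r \<partial>lborel)"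
    by (rule nn_integral_cong_AE, rule AE_mp[OF AE_lborel_singleton[of a]], rule AE_I2)
      (auto split: split_indicator)
  also have "\<dots> = ennreal (0 - (- (a powr (- s) / s)))"
  proof (rule nn_integral_FTC_atLeast)
    show "((\<lambda>r. - (r powr (- s) / s)) has_real_derivative r powr (- 1 - s)) (at r)" if "a \<le> r" for r
      using that assms by (auto intro!: derivative_eq_intros simp: field_simps powr_minus powr_diff powr_add)
    have "((\<lambda>r. r powr (- s)) \<longlongrightarrow> 0) at_top"
      using \<open>s > 0\<close> by (intro tendsto_neg_powr filterlim_ident) auto
    then show "((\<lambda>r. - (r powr (- s) / s)) \<longlongrightarrow> 0) at_top"
      using tendsto_minus[OF tendsto_divide_zero[of _ _ s]] by fastforce
  qed auto
  finally show ?thesis by simp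
qed

definition sphere_area :: "'a::euclidean_space itself \<Rightarrow> real" where
  "sphere_area _ = DIM('a) * unit_ball_vol DIM('a)"

lemma sphere_area_pos: "sphere_area TYPE('a::euclidean_space) > 0"
  by (simp add: sphere_area_def)

lemma kernel_tail:
  fixes s a :: real
  assumes "s > 0" "a > 0"
  shows "(\<integral>\<^sup>+ x. ennreal (norm x powr (- (DIM('a) + s))) * indicator {x. a < norm x} x \<partial>(lborel :: 'a::euclidean_space measure))
    = ennreal (sphere_area TYPE('a) * (a powr (- s) / s))"
proof -
  have "(\<integral>\<^sup>+ x. ennreal (norm x powr (- (DIM('a) + s))) * indicator {x. a < norm x} x \<partial>(lborel :: 'a measure))
      = (\<integral>\<^sup>+ x. ennreal (norm x powr (- (DIM('a) + s))) * indicator {a<..} (norm x) \<partial>(lborel :: 'a measure))"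
    by (intro nn_integral_cong) (auto split: split_indicator)
  also have "\<dots> = ennreal (sphere_area TYPE('a)) * (\<integral>\<^sup>+ r. ennreal (r powr (- (DIM('a) + s))) * indicator {a<..} r * ennreal (r ^ (DIM('a) - 1)) * indicator {0<..} r \<partial>lborel)"
    unfolding sphere_area_def by (rule nn_integral_radial) simp
  also have "(\<integral>\<^sup>+ r. ennreal (r powr (- (DIM('a) + s))) * indicator {a<..} r * ennreal (r ^ (DIM('a) - 1)) * indicator {0<..} r \<partial>lborel)
     = (\<integral>\<^sup>+ r. ennreal (r powr (- 1 - s)) * indicator {a<..} r \<partial>lborel)"
  proof (intro nn_integral_cong)
    fix r :: real
    have "r powr (- (DIM('a) + s)) * r ^ (DIM('a) - 1) = r powr (- 1 - s)" if "r > 0"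
    proof -
      have "r ^ (DIM('a) - 1) = r powr (real DIM('a) - 1)"
        using that by (simp add: powr_realpow[symmetric] of_nat_diff DIM_positive Suc_leI)
      then show ?thesis by (simp add: powr_add[symmetric] algebra_simps)
    qed
    then show "ennreal (r powr (- (DIM('a) + s))) * indicator {a<..} r * ennreal (r ^ (DIM('a) - 1)) * indicator {0<..} r = ennreal (r powr (- 1 - s)) * indicator {a<..} r"
      using \<open>a > 0\<close> by (auto split: split_indicator simp: ennreal_mult'[symmetric])
  qed
  also have "\<dots> = ennreal (a powr (- s) / s)" by (rule nn_integral_powr_tail) fact+
  finally show ?thesis
    using sphere_area_pos[where 'a='a] by (simp add: ennreal_mult'[symmetric])
qed

lemma weighted_gaussian_integral:
  fixes s :: real
  assumes "s < DIM('a)"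
  shows "(\<integral>\<^sup>+ x. ennreal (norm x powr (- s) * exp (- (norm x)\<^sup>2)) \<partial>(lborel :: 'a::euclidean_space measure))
    = ennreal (sphere_area TYPE('a) * (Gamma ((DIM('a) - s) / 2) / 2))"
proof -
  have "(\<integral>\<^sup>+ x. ennreal (norm x powr (- s) * exp (- (norm x)\<^sup>2)) \<partial>(lborel :: 'a measure))
    = ennreal (sphere_area TYPE('a)) * (\<integral>\<^sup>+ r. ennreal (r powr (- s) * exp (- r\<^sup>2)) * ennreal (r ^ (DIM('a) - 1)) * indicator {0<..} r \<partial>lborel)"
    unfolding sphere_area_def by (rule nn_integral_radial) simp
  also have "(\<integral>\<^sup>+ r. ennreal (r powr (- s) * exp (- r\<^sup>2)) * ennreal (r ^ (DIM('a) - 1)) * indicator {0<..} r \<partial>lborel)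
     = (\<integral>\<^sup>+ r. ennreal (r powr (real DIM('a) - 1 - s) * exp (- r\<^sup>2)) * indicator {0<..} r \<partial>lborel)"
  proof (intro nn_integral_cong)
    fix r :: real
    have "r powr (- s) * r ^ (DIM('a) - 1) = r powr (real DIM('a) - 1 - s)" if "r > 0"
    proof -
      have "r ^ (DIM('a) - 1) = r powr (real DIM('a) - 1)"
        using that by (simp add: powr_realpow[symmetric] of_nat_diff DIM_positive Suc_leI)
      then show ?thesis by (simp add: powr_add[symmetric] algebra_simps)
    qed
    then show "ennreal (r powr (- s) * exp (- r\<^sup>2)) * ennreal (r ^ (DIM('a) - 1)) * indicator {0<..} r = ennreal (r powr (real DIM('a) - 1 - s) * exp (- r\<^sup>2)) * indicator {0<..} r"
      by (auto split: split_indicator simp: ennreal_mult'[symmetric] mult_ac)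
  qed
  also have "\<dots> = ennreal (Gamma ((DIM('a) - s) / 2) / 2)"
    using nn_integral_powr_gaussian[of "real DIM('a) - 1 - s"] assms by (simp add: algebra_simps)
  finally show ?thesis
    using sphere_area_pos[where 'a='a] by (simp add: ennreal_mult'[symmetric])
qed

lemma sphere_area_real: "sphere_area TYPE(real) = 2"
  by (simp add: sphere_area_def)

lemma gaussian_integral_real:
  "(\<integral>\<^sup>+ (v::real). ennreal (exp (- v\<^sup>2)) \<partial>lborel) = ennreal (sqrt pi)"
proof -
  have "(\<integral>\<^sup>+ (v::real). ennreal (exp (- v\<^sup>2)) \<partial>lborel) = (\<integral>\<^sup>+ (v::real). ennreal (norm v powr (- 0) * exp (- (norm v)\<^sup>2)) \<partial>lborel)"
    by (rule nn_integral_cong_AE, rule AE_mp[OF AE_lborel_singleton[of "0::real"]], rule AE_I2) auto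
  also have "\<dots> = ennreal (sqrt pi)"
    by (subst weighted_gaussian_integral) (auto simp: sphere_area_real Gamma_one_half_real)
  finally show ?thesis .
qed

section \<open>Translation increments of the Gaussian\<close>

definition gaussian :: "'a::euclidean_space \<Rightarrow> real" where
  "gaussian x = exp (- (norm x)\<^sup>2)"

lemma gaussian_measurable [measurable]: "gaussian \<in> borel_measurable borel"
  unfolding gaussian_def by measurable

lemma gaussian_pos: "gaussian x > 0"
  by (simp add: gaussian_def)

lemma gaussian_prod: "gaussian (x::'a::euclidean_space) = (\<Prod>b\<in>Basis. exp (- (x \<bullet> b)\<^sup>2))"
proof -
  have "(norm x)\<^sup>2 = (\<Sum>b\<in>Basis. (x \<bullet> b)\<^sup>2)"
    by (subst power2_norm_eq_inner, subst euclidean_inner[of x x]) (simp add: power2_eq_square)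
  then show ?thesis by (simp add: gaussian_def exp_sum sum_negf[symmetric])
qed

text \<open>The Gaussian factors over the coordinates, and every coordinate other than \<open>b\<close> contributes
\<open>\<surd>\<pi>\<close>.\<close>

lemma gaussian_slice:
  fixes b :: "'a::euclidean_space"
  assumes b: "b \<in> Basis" and [measurable]: "A \<in> sets borel"
  shows "(\<integral>\<^sup>+ x. indicator A (x \<bullet> b) * ennreal (gaussian x) \<partial>lborel)
    = ennreal (pi powr ((DIM('a) - 1) / 2)) * (\<integral>\<^sup>+ (v::real). indicator A v * ennreal (exp (- v\<^sup>2)) \<partial>lborel)"
proof -
  let ?f = "\<lambda>c v. (if c = b then indicator A v else 1) * ennreal (exp (- v\<^sup>2))"
  have "(\<integral>\<^sup>+ x. indicator A (x \<bullet> b) * ennreal (gaussian x) \<partial>lborel)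
      = (\<integral>\<^sup>+ x. (\<Prod>c\<in>Basis. ?f c (x \<bullet> c)) \<partial>(lborel :: 'a measure))"
    using b by (intro nn_integral_cong) (simp add: gaussian_prod prod.distrib prod_ennreal)
  also have "\<dots> = (\<Prod>c\<in>Basis. \<integral>\<^sup>+ v. ?f c v \<partial>lborel)"
    by (rule nn_integral_lborel_prod) auto
  also have "\<dots> = (\<integral>\<^sup>+ v. ?f b v \<partial>lborel) * (\<Prod>c\<in>Basis - {b}. \<integral>\<^sup>+ v. ?f c v \<partial>lborel)"
    using b by (subst prod.remove[of _ b]) auto
  also have "(\<Prod>c\<in>Basis - {b}. \<integral>\<^sup>+ v. ?f c v \<partial>lborel) = (\<Prod>c\<in>Basis - {b}. ennreal (sqrt pi))"
    by (intro prod.cong) (auto simp: gaussian_integral_real)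
  also have "\<dots> = ennreal (sqrt pi ^ (DIM('a) - 1))"
    using b by (simp add: ennreal_power card_Diff_singleton)
  also have "sqrt pi ^ (DIM('a) - 1) = pi powr ((DIM('a) - 1) / 2)"
    by (simp add: powr_half_sqrt[symmetric] powr_realpow[symmetric] powr_powr of_nat_diff DIM_positive Suc_leI)
  finally show ?thesis by (simp add: mult.commute)
qed

lemma gaussian_integrable: "(\<integral>\<^sup>+ x. ennreal (gaussian x) \<partial>(lborel :: 'a::euclidean_space measure)) < \<infinity>"
proof -
  obtain b :: 'a where "b \<in> Basis" using nonempty_Basis by blast
  from gaussian_slice[OF this, of UNIV] show ?thesis
    by (simp add: gaussian_integral_real ennreal_mult_less_top)
qed

text \<open>The points \<open>y\<close> that the translation by \<open>q\<close> brings closer to the origin form a half-space, which the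
translation maps to the half-space \<open>2 z \<bullet> q < |q|\<^sup>2\<close>. The integral is thus the difference of
the Gaussian measures of two parallel half-spaces, that is, the Gaussian measure of the slab between
them; a rotation makes the slab orthogonal to a coordinate axis.\<close>

lemma gaussian_increment:
  fixes q :: "'a::euclidean_space"
  shows "(\<integral>\<^sup>+ y. indicator {y. norm (y + q) < norm y} y * ennreal (gaussian (y + q) - gaussian y) \<partial>lborel)
    = ennreal (pi powr ((DIM('a) - 1) / 2)) * (\<integral>\<^sup>+ (v::real). indicator {v. \<bar>v\<bar> < norm q / 2} v * ennreal (exp (- v\<^sup>2)) \<partial>lborel)"
proof -
  let ?d = "\<lambda>y. gaussian (y + q) - gaussian y"
  have closer: "norm (y + q) < norm y \<longleftrightarrow> 2 * (y \<bullet> q) < - (norm q)\<^sup>2" for y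
  proof -
    have "norm (y + q) < norm y \<longleftrightarrow> (norm (y + q))\<^sup>2 < (norm y)\<^sup>2"
      by (metis norm_ge_zero power2_less_imp_less power_strict_mono zero_less_numeral)
    also have "(norm (y + q))\<^sup>2 = (norm y)\<^sup>2 + 2 * (y \<bullet> q) + (norm q)\<^sup>2"
      by (simp add: power2_norm_eq_inner inner_add_left inner_add_right inner_commute)
    finally show ?thesis by linarith
  qed
  define S where "S = (\<integral>\<^sup>+ z. indicator {z. 2 * (z \<bullet> q) < - (norm q)\<^sup>2} z * ennreal (gaussian z) \<partial>lborel)"
  have "S \<le> (\<integral>\<^sup>+ z. ennreal (gaussian z) \<partial>(lborel :: 'a measure))"
    unfolding S_def by (intro nn_integral_mono) (auto split: split_indicator)
  then have S_fin: "S < \<infinity>" using gaussian_integrable[where 'a='a] by (rule le_less_trans)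
  have [measurable]: "(\<lambda>y::'a. y + q) \<in> borel_measurable borel" by simp
  have "(\<integral>\<^sup>+ y. indicator {y. norm (y + q) < norm y} y * ennreal (?d y) \<partial>lborel) + S
      = (\<integral>\<^sup>+ y. indicator {y. norm (y + q) < norm y} y * ennreal (?d y)
          + indicator {z. 2 * (z \<bullet> q) < - (norm q)\<^sup>2} y * ennreal (gaussian y) \<partial>lborel)"
    unfolding S_def by (rule nn_integral_add[symmetric]) measurable
  also have "\<dots> = (\<integral>\<^sup>+ y. indicator {z. 2 * (z \<bullet> q) < (norm q)\<^sup>2} (y + q) * ennreal (gaussian (y + q)) \<partial>lborel)"
  proof (intro nn_integral_cong)
    fix y
    have "gaussian y \<le> gaussian (y + q)" if "norm (y + q) < norm y"
      using that by (auto simp: gaussian_def intro!: power_mono)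
    moreover have "2 * ((y + q) \<bullet> q) < (norm q)\<^sup>2 \<longleftrightarrow> 2 * (y \<bullet> q) < - (norm q)\<^sup>2"
      by (auto simp: inner_add_left power2_norm_eq_inner)
    ultimately show "indicator {y. norm (y + q) < norm y} y * ennreal (?d y)
          + indicator {z. 2 * (z \<bullet> q) < - (norm q)\<^sup>2} y * ennreal (gaussian y)
        = indicator {z. 2 * (z \<bullet> q) < (norm q)\<^sup>2} (y + q) * ennreal (gaussian (y + q))"
      using gaussian_pos[of y] gaussian_pos[of "y + q"]
      by (auto simp: closer ennreal_plus[symmetric] less_imp_le split: split_indicator simp del: ennreal_plus)
  qed
  also have "\<dots> = (\<integral>\<^sup>+ z. indicator {z. 2 * (z \<bullet> q) < (norm q)\<^sup>2} z * ennreal (gaussian z) \<partial>lborel)"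
    by (rule nn_integral_lborel_translate) measurable
  \<comment> \<open>Split off the smaller half-space; its Gaussian measure \<open>S\<close> is finite and cancels.\<close>
  also have "\<dots> = (\<integral>\<^sup>+ z. indicator {z. - (norm q)\<^sup>2 \<le> 2 * (z \<bullet> q) \<and> 2 * (z \<bullet> q) < (norm q)\<^sup>2} z * ennreal (gaussian z)
        + indicator {z. 2 * (z \<bullet> q) < - (norm q)\<^sup>2} z * ennreal (gaussian z) \<partial>lborel)"
  proof (intro nn_integral_cong)
    fix z :: 'a
    have "2 * (z \<bullet> q) < (norm q)\<^sup>2" if "2 * (z \<bullet> q) < - (norm q)\<^sup>2"
      using that zero_le_power2[of "norm q"] by linarith
    then show "indicator {z. 2 * (z \<bullet> q) < (norm q)\<^sup>2} z * ennreal (gaussian z)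
      = indicator {z. - (norm q)\<^sup>2 \<le> 2 * (z \<bullet> q) \<and> 2 * (z \<bullet> q) < (norm q)\<^sup>2} z * ennreal (gaussian z)
        + indicator {z. 2 * (z \<bullet> q) < - (norm q)\<^sup>2} z * ennreal (gaussian z)"
      by (auto split: split_indicator)
  qed
  also have "\<dots> = (\<integral>\<^sup>+ z. indicator {z. - (norm q)\<^sup>2 \<le> 2 * (z \<bullet> q) \<and> 2 * (z \<bullet> q) < (norm q)\<^sup>2} z * ennreal (gaussian z) \<partial>lborel) + S"
    unfolding S_def by (rule nn_integral_add) measurable
  finally have "(\<integral>\<^sup>+ y. indicator {y. norm (y + q) < norm y} y * ennreal (?d y) \<partial>lborel)
      = (\<integral>\<^sup>+ z. indicator {z. - (norm q)\<^sup>2 \<le> 2 * (z \<bullet> q) \<and> 2 * (z \<bullet> q) < (norm q)\<^sup>2} z * ennreal (gaussian z) \<partial>lborel)"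
    using S_fin by (auto simp: add.commute[of _ S] ennreal_add_left_cancel)
  also have "\<dots> = ennreal (pi powr ((DIM('a) - 1) / 2)) * (\<integral>\<^sup>+ (v::real). indicator {v. \<bar>v\<bar> < norm q / 2} v * ennreal (exp (- v\<^sup>2)) \<partial>lborel)"
  proof (cases "q = 0")
    case True
    have "{v::real. \<bar>v\<bar> < 0} = {}" by auto
    with True show ?thesis by simp
  next
    case False
    define r where "r = norm q"
    have r: "r > 0" using False by (simp add: r_def)
    obtain b :: 'a where b: "b \<in> Basis" using nonempty_Basis by blast
    have "norm (r *\<^sub>R b) = norm q" using b r by (simp add: r_def)
    then obtain T where T: "orthogonal_transformation T" and Tb: "T (r *\<^sub>R b) = q"
      using orthogonal_transformation_exists_euclidean by blast
    have [measurable]: "{- r / 2..<r / 2} \<in> sets borel" by simp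
    have inner_T: "T z \<bullet> q = r * (z \<bullet> b)" for z
    proof -
      have "T z \<bullet> q = T z \<bullet> T (r *\<^sub>R b)" by (simp add: Tb)
      also have "\<dots> = z \<bullet> (r *\<^sub>R b)" using T by (simp add: orthogonal_transformation_def)
      finally show ?thesis by simp
    qed
    have "(\<integral>\<^sup>+ z. indicator {z. - (norm q)\<^sup>2 \<le> 2 * (z \<bullet> q) \<and> 2 * (z \<bullet> q) < (norm q)\<^sup>2} z * ennreal (gaussian z) \<partial>lborel)
      = (\<integral>\<^sup>+ z. indicator {z. - (norm q)\<^sup>2 \<le> 2 * (z \<bullet> q) \<and> 2 * (z \<bullet> q) < (norm q)\<^sup>2} (T z) * ennreal (gaussian (T z)) \<partial>lborel)"
      by (rule nn_integral_lborel_orthogonal[OF _ T, symmetric]) measurable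
    also have "\<dots> = (\<integral>\<^sup>+ z. indicator {- r / 2..<r / 2} (z \<bullet> b) * ennreal (gaussian z) \<partial>lborel)"
    proof (intro nn_integral_cong)
      fix z
      have "gaussian (T z) = gaussian z" using T by (simp add: gaussian_def orthogonal_transformation)
      moreover have "(- r\<^sup>2 \<le> 2 * (r * (z \<bullet> b))) = (- r / 2 \<le> z \<bullet> b)"
      proof -
        have "- r\<^sup>2 \<le> 2 * (r * (z \<bullet> b)) \<longleftrightarrow> r * (- r) \<le> r * (2 * (z \<bullet> b))"
          by (simp add: power2_eq_square mult_ac)
        also have "\<dots> \<longleftrightarrow> - r \<le> 2 * (z \<bullet> b)" by (rule mult_le_cancel_left_pos[OF r])
        also have "\<dots> \<longleftrightarrow> - r / 2 \<le> z \<bullet> b" by auto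
        finally show ?thesis .
      qed
      moreover have "(2 * (r * (z \<bullet> b)) < r\<^sup>2) = (z \<bullet> b < r / 2)"
      proof -
        have "2 * (r * (z \<bullet> b)) < r\<^sup>2 \<longleftrightarrow> r * (2 * (z \<bullet> b)) < r * r"
          by (simp add: power2_eq_square mult_ac)
        also have "\<dots> \<longleftrightarrow> 2 * (z \<bullet> b) < r" by (rule mult_less_cancel_left_pos[OF r])
        also have "\<dots> \<longleftrightarrow> z \<bullet> b < r / 2" by auto
        finally show ?thesis .
      qed
      ultimately show "indicator {z. - (norm q)\<^sup>2 \<le> 2 * (z \<bullet> q) \<and> 2 * (z \<bullet> q) < (norm q)\<^sup>2} (T z) * ennreal (gaussian (T z))
        = indicator {- r / 2..<r / 2} (z \<bullet> b) * ennreal (gaussian z)"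
        by (auto simp: inner_T r_def[symmetric] split: split_indicator)
    qed
    also have "\<dots> = ennreal (pi powr ((DIM('a) - 1) / 2)) * (\<integral>\<^sup>+ (v::real). indicator {- r / 2..<r / 2} v * ennreal (exp (- v\<^sup>2)) \<partial>lborel)"
      by (rule gaussian_slice[OF b]) simp
    also have "(\<integral>\<^sup>+ (v::real). indicator {- r / 2..<r / 2} v * ennreal (exp (- v\<^sup>2)) \<partial>lborel)
        = (\<integral>\<^sup>+ (v::real). indicator {v. \<bar>v\<bar> < norm q / 2} v * ennreal (exp (- v\<^sup>2)) \<partial>lborel)"
      by (rule nn_integral_cong_AE, rule AE_mp[OF AE_lborel_singleton[of "- r / 2"]], rule AE_I2)
        (auto simp: r_def split: split_indicator)
    finally show ?thesis .
  qed
  finally show ?thesis .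
qed

section \<open>The fractional kernel on ordered pairs of points\<close>

definition kernel :: "real \<Rightarrow> 'a::euclidean_space \<Rightarrow> real" where
  "kernel s z = norm z powr (- (real DIM('a) + s))"

lemma kernel_measurable [measurable]: "kernel s \<in> borel_measurable borel"
  unfolding kernel_def by measurable

lemma kernel_nonneg [simp]: "kernel s z \<ge> 0"
  by (simp add: kernel_def)

lemma kernel_minus_commute: "kernel s (x - y) = kernel s (y - x)"
  by (simp add: kernel_def norm_minus_commute)

definition hardy :: "real \<Rightarrow> ('a::euclidean_space \<Rightarrow> real) \<Rightarrow> ennreal" where
  "hardy s u = (\<integral>\<^sup>+ x. ennreal (\<bar>u x\<bar> * norm x powr (- s)) \<partial>lborel)"

text \<open>A parameter \<open>l > 1\<close> keeps the pairs \<open>(x, y)\<close> away from the sphere \<open>|x| = |y|\<close>, so that the kernel mass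
seen from one of the two points is finite; \<open>l = 1\<close> gives all pairs with \<open>|x| < |y|\<close>.\<close>

definition ordered_energy :: "real \<Rightarrow> real \<Rightarrow> ('a::euclidean_space \<Rightarrow> 'a \<Rightarrow> ennreal) \<Rightarrow> ennreal" where
  "ordered_energy s l G =
     (\<integral>\<^sup>+ y. (\<integral>\<^sup>+ x. indicator {x. l * norm x < norm y} x * G x y * ennreal (kernel s (x - y)) \<partial>lborel) \<partial>lborel)"

lemma ordered_energy_Fubini:
  fixes G :: "'a::euclidean_space \<Rightarrow> 'a \<Rightarrow> ennreal"
  assumes [measurable]: "case_prod G \<in> borel_measurable (borel \<Otimes>\<^sub>M borel)"
  shows "ordered_energy s l G =
     (\<integral>\<^sup>+ x. (\<integral>\<^sup>+ y. indicator {x. l * norm x < norm y} x * G x y * ennreal (kernel s (x - y)) \<partial>lborel) \<partial>lborel)"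
  unfolding ordered_energy_def by (rule lborel_pair.Fubini') measurable

lemma ordered_energy_add:
  fixes G G' :: "'a::euclidean_space \<Rightarrow> 'a \<Rightarrow> ennreal"
  assumes [measurable]: "case_prod G \<in> borel_measurable (borel \<Otimes>\<^sub>M borel)"
     "case_prod G' \<in> borel_measurable (borel \<Otimes>\<^sub>M borel)"
  shows "ordered_energy s l (\<lambda>x y. G x y + G' x y) = ordered_energy s l G + ordered_energy s l G'"
  unfolding ordered_energy_def by (simp add: ring_distribs nn_integral_add)

lemma ordered_energy_cong:
  assumes "\<And>x y. l * norm x < norm y \<Longrightarrow> G x y = G' x y"
  shows "ordered_energy s l G = ordered_energy s l G'"
  unfolding ordered_energy_def
  using assms by (intro nn_integral_cong) (auto split: split_indicator)

text \<open>The sequence along which the restriction to \<open>l |x| < |y|\<close> is removed.\<close>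

definition threshold :: "nat \<Rightarrow> real" where "threshold n = 1 + 1 / Suc n"

lemma threshold_gt_1: "threshold n > 1"
  by (simp add: threshold_def)

lemma threshold_decseq: "m \<le> n \<Longrightarrow> threshold n \<le> threshold m"
  by (simp add: threshold_def frac_le)

lemma ordered_indicator_SUP:
  "(indicator {x. 1 * norm x < norm y} x :: ennreal) = (SUP n. indicator {x. threshold n * norm x < norm y} x)"
proof (cases "norm x < norm y")
  case True
  have "(\<lambda>n. threshold n * norm x) \<longlonglongrightarrow> (1 + 0) * norm x"
    unfolding threshold_def by (intro tendsto_intros LIMSEQ_Suc lim_1_over_n)
  with True have "\<forall>\<^sub>F n in sequentially. threshold n * norm x < norm y"
    by (intro order_tendstoD(2)) auto
  then obtain n where "threshold n * norm x < norm y" by (auto simp: eventually_sequentially)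
  with True have "indicator {x. 1 * norm x < norm y} x \<le> (indicator {x. threshold n * norm x < norm y} x :: ennreal)"
    by simp
  also have "\<dots> \<le> (SUP n. indicator {x. threshold n * norm x < norm y} x)" by (rule SUP_upper) simp
  finally have "indicator {x. 1 * norm x < norm y} x \<le> (SUP n. indicator {x. threshold n * norm x < norm y} x :: ennreal)" .
  moreover have "(SUP n. indicator {x. threshold n * norm x < norm y} x :: ennreal) \<le> indicator {x. 1 * norm x < norm y} x"
    using True by (intro SUP_least) (auto split: split_indicator)
  ultimately show ?thesis by (rule antisym)
next
  case False
  have "\<not> threshold n * norm x < norm y" for n
  proof -
    have "1 * norm x \<le> threshold n * norm x"
      using threshold_gt_1[of n] by (intro mult_right_mono) auto
    with False show ?thesis by simp
  qed
  with False show ?thesis by simp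
qed

lemma ordered_energy_mono:
  assumes "l' \<le> l"
  shows "ordered_energy s l G \<le> ordered_energy s l' G"
  unfolding ordered_energy_def
proof (intro nn_integral_mono mult_right_mono)
  fix y x :: 'a
  have "l' * norm x \<le> l * norm x" using assms by (intro mult_right_mono) auto
  then show "(indicator {x. l * norm x < norm y} x :: ennreal) \<le> indicator {x. l' * norm x < norm y} x"
    by (auto split: split_indicator)
qed auto

lemma ordered_energy_SUP:
  fixes G :: "'a::euclidean_space \<Rightarrow> 'a \<Rightarrow> ennreal"
  assumes [measurable]: "case_prod G \<in> borel_measurable (borel \<Otimes>\<^sub>M borel)"
  shows "ordered_energy s 1 G = (SUP n. ordered_energy s (threshold n) G)"
proof -
  let ?k = "\<lambda>n x y. indicator {x. threshold n * norm x < norm y} x * G x y * ennreal (kernel s (x - y))"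
  have mono: "?k m x y \<le> ?k n x y" if "m \<le> n" for m n x y
  proof (intro mult_right_mono)
    have "threshold n * norm x \<le> threshold m * norm x"
      using threshold_decseq[OF that] by (intro mult_right_mono) auto
    then show "(indicator {x. threshold m * norm x < norm y} x :: ennreal) \<le> indicator {x. threshold n * norm x < norm y} x"
      by (auto split: split_indicator)
  qed auto
  have [measurable]: "(\<lambda>x. G x y) \<in> borel_measurable borel" for y by measurable
  have pt: "indicator {x. 1 * norm x < norm y} x * G x y * ennreal (kernel s (x - y)) = (SUP n. ?k n x y)" for x y
    by (simp only: ordered_indicator_SUP SUP_mult_right_ennreal)
  have "ordered_energy s 1 G = (\<integral>\<^sup>+ y. (\<integral>\<^sup>+ x. (SUP n. ?k n x y) \<partial>lborel) \<partial>lborel)"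
    unfolding ordered_energy_def pt ..
  also have "\<dots> = (\<integral>\<^sup>+ y. (SUP n. \<integral>\<^sup>+ x. ?k n x y \<partial>lborel) \<partial>lborel)"
    by (intro nn_integral_cong nn_integral_monotone_convergence_SUP)
      (auto simp: incseq_def le_fun_def intro: mono)
  also have "\<dots> = (SUP n. \<integral>\<^sup>+ y. (\<integral>\<^sup>+ x. ?k n x y \<partial>lborel) \<partial>lborel)"
    by (intro nn_integral_monotone_convergence_SUP)
      (auto simp: incseq_def le_fun_def intro!: mono nn_integral_mono)
  finally show ?thesis by (simp add: ordered_energy_def)
qed

text \<open>Move \<open>e\<close> to \<open>x\<close> by a rotation followed by the dilation with factor \<open>|x|\<close>: the dilation contributes
\<open>|x|\<^sup>N\<close> from the volume element and \<open>|x|\<^bsup>-N-s\<^esup>\<close> from the kernel.\<close>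

lemma homogeneous_kernel_integral:
  fixes k :: "'a::euclidean_space \<Rightarrow> 'a \<Rightarrow> ennreal"
  assumes [measurable]: "\<And>x. k x \<in> borel_measurable borel"
    and rot: "\<And>T x y. orthogonal_transformation T \<Longrightarrow> k (T x) (T y) = k x y"
    and hom: "\<And>c x y. c > 0 \<Longrightarrow> k (c *\<^sub>R x) (c *\<^sub>R y) = ennreal (c powr (- (real DIM('a) + s))) * k x y"
    and e: "norm e = 1" and x: "x \<noteq> 0"
  shows "(\<integral>\<^sup>+ y. k x y \<partial>lborel) = ennreal (norm x powr (- s)) * (\<integral>\<^sup>+ y. k e y \<partial>lborel)"
proof -
  define r where "r = norm x"
  have r: "r > 0" using x by (simp add: r_def)
  have "norm e = norm ((1 / r) *\<^sub>R x)" using e r by (simp add: r_def)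
  then obtain T where T: "orthogonal_transformation T" and Te: "T e = (1 / r) *\<^sub>R x"
    using orthogonal_transformation_exists_euclidean by blast
  have x_eq: "x = r *\<^sub>R T e" using r by (simp add: Te)
  have "(\<integral>\<^sup>+ y. k x y \<partial>lborel) = ennreal (r ^ DIM('a)) * (\<integral>\<^sup>+ y. k x (r *\<^sub>R y) \<partial>lborel)"
    by (rule nn_integral_lborel_dilate[OF _ r]) measurable
  also have "(\<integral>\<^sup>+ y. k x (r *\<^sub>R y) \<partial>lborel) = (\<integral>\<^sup>+ y. ennreal (r powr (- (real DIM('a) + s))) * k (T e) y \<partial>lborel)"
    by (simp add: x_eq hom r)
  also have "\<dots> = ennreal (r powr (- (real DIM('a) + s))) * (\<integral>\<^sup>+ y. k (T e) y \<partial>lborel)"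
    by (rule nn_integral_cmult) measurable
  also have "(\<integral>\<^sup>+ y. k (T e) y \<partial>lborel) = (\<integral>\<^sup>+ y. k (T e) (T y) \<partial>lborel)"
    by (rule nn_integral_lborel_orthogonal[OF _ T, symmetric]) measurable
  also have "\<dots> = (\<integral>\<^sup>+ y. k e y \<partial>lborel)" by (simp add: rot[OF T])
  also have "ennreal (r ^ DIM('a)) * (ennreal (r powr (- (real DIM('a) + s))) * (\<integral>\<^sup>+ y. k e y \<partial>lborel))
      = ennreal (r ^ DIM('a) * r powr (- (real DIM('a) + s))) * (\<integral>\<^sup>+ y. k e y \<partial>lborel)"
    using r by (simp add: ennreal_mult mult.assoc)
  also have "r ^ DIM('a) * r powr (- (real DIM('a) + s)) = r powr (- s)"
    using r by (simp add: powr_realpow[symmetric] powr_add[symmetric])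
  finally show ?thesis by (simp add: r_def)
qed

lemma kernel_orthogonal:
  fixes T :: "'a::euclidean_space \<Rightarrow> 'a"
  assumes "orthogonal_transformation T"
  shows "kernel s (T x - T y) = kernel s (x - y)"
  using assms by (simp add: kernel_def orthogonal_transformation linear_diff[symmetric])

lemma kernel_scale:
  fixes x y :: "'a::euclidean_space"
  assumes "c > 0"
  shows "kernel s (c *\<^sub>R x - c *\<^sub>R y) = c powr (- (real DIM('a) + s)) * kernel s (x - y)"
  using assms by (simp add: kernel_def scaleR_diff_right[symmetric] powr_mult)

definition outer_mass :: "real \<Rightarrow> real \<Rightarrow> 'a::euclidean_space \<Rightarrow> ennreal" where
  "outer_mass s l x = (\<integral>\<^sup>+ y. indicator {x. l * norm x < norm y} x * ennreal (kernel s (x - y)) \<partial>lborel)"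

definition inner_mass :: "real \<Rightarrow> real \<Rightarrow> 'a::euclidean_space \<Rightarrow> ennreal" where
  "inner_mass s l y = (\<integral>\<^sup>+ x. indicator {x. l * norm x < norm y} x * ennreal (kernel s (x - y)) \<partial>lborel)"

lemma outer_mass_homogeneous:
  fixes x e :: "'a::euclidean_space"
  assumes "norm e = 1" "x \<noteq> 0"
  shows "outer_mass s l x = ennreal (norm x powr (- s)) * outer_mass s l e"
  unfolding outer_mass_def
proof (rule homogeneous_kernel_integral[OF _ _ _ assms])
  show "(\<lambda>y. indicator {x. l * norm x < norm y} x * ennreal (kernel s (x - y))) \<in> borel_measurable borel" for x :: 'a
    by measurable
  show "indicator {x. l * norm x < norm (T y)} (T x) * ennreal (kernel s (T x - T y))
      = indicator {x. l * norm x < norm y} x * ennreal (kernel s (x - y))"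
    if T: "orthogonal_transformation T" for T :: "'a \<Rightarrow> 'a" and x y
    using T by (simp add: kernel_orthogonal[OF T] orthogonal_transformation indicator_def)
  show "indicator {x. l * norm x < norm (c *\<^sub>R y)} (c *\<^sub>R x) * ennreal (kernel s (c *\<^sub>R x - c *\<^sub>R y))
      = ennreal (c powr (- (real DIM('a) + s))) * (indicator {x. l * norm x < norm y} x * ennreal (kernel s (x - y)))"
    if "c > 0" for c and x y :: 'a
    using that by (auto simp: kernel_scale ennreal_mult mult.left_commute[of l c] split: split_indicator)
qed

lemma inner_mass_homogeneous:
  fixes y e :: "'a::euclidean_space"
  assumes "norm e = 1" "y \<noteq> 0"
  shows "inner_mass s l y = ennreal (norm y powr (- s)) * inner_mass s l e"
  unfolding inner_mass_def
proof (rule homogeneous_kernel_integral[OF _ _ _ assms])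
  show "(\<lambda>x. indicator {x. l * norm x < norm y} x * ennreal (kernel s (x - y))) \<in> borel_measurable borel" for y :: 'a
    by measurable
  show "indicator {x. l * norm x < norm (T y)} (T x) * ennreal (kernel s (T x - T y))
      = indicator {x. l * norm x < norm y} x * ennreal (kernel s (x - y))"
    if T: "orthogonal_transformation T" for T :: "'a \<Rightarrow> 'a" and x y
    using T by (simp add: kernel_orthogonal[OF T] orthogonal_transformation indicator_def)
  show "indicator {x. l * norm x < norm (c *\<^sub>R y)} (c *\<^sub>R x) * ennreal (kernel s (c *\<^sub>R x - c *\<^sub>R y))
      = ennreal (c powr (- (real DIM('a) + s))) * (indicator {x. l * norm x < norm y} x * ennreal (kernel s (x - y)))"
    if "c > 0" for c and x y :: 'a
    using that by (auto simp: kernel_scale ennreal_mult mult.left_commute[of l c] split: split_indicator)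
qed

text \<open>The points \<open>x\<close> with \<open>l |x| < 1\<close> fill a bounded set at distance at least \<open>1 - 1/l\<close> from the unit
vector \<open>e\<close>.\<close>

lemma inner_mass_finite:
  fixes e :: "'a::euclidean_space"
  assumes e: "norm e = 1" and "l > 1" "s > 0"
  shows "inner_mass s l e < \<infinity>"
proof -
  define C where "C = (1 - 1 / l) powr (- (real DIM('a) + s))"
  have "inner_mass s l e \<le> (\<integral>\<^sup>+ x. ennreal C * indicator (cball (0::'a) 1) x \<partial>lborel)"
    unfolding inner_mass_def
  proof (intro nn_integral_mono)
    fix x :: 'a
    show "indicator {x. l * norm x < norm e} x * ennreal (kernel s (x - e)) \<le> ennreal C * indicator (cball 0 1) x"
    proof (cases "l * norm x < 1")
      case True
      then have x: "norm x < 1 / l" using \<open>l > 1\<close> by (simp add: field_simps)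
      also have "1 / l < 1" using \<open>l > 1\<close> by simp
      finally have "norm x \<le> 1" by simp
      have "1 - 1 / l \<le> norm (x - e)"
        using x e norm_triangle_ineq2[of e x] by (simp add: norm_minus_commute)
      moreover have "0 < 1 - 1 / l" using \<open>l > 1\<close> by simp
      ultimately have "kernel s (x - e) \<le> C"
        unfolding kernel_def C_def using \<open>s > 0\<close> by (intro powr_mono2') auto
      with True e \<open>norm x \<le> 1\<close> show ?thesis by (simp add: ennreal_leI)
    qed (use e in simp)
  qed
  also have "\<dots> = ennreal C * emeasure lborel (cball (0::'a) 1)" by (rule nn_integral_cmult_indicator) simp
  also have "\<dots> < \<infinity>" by (simp add: emeasure_cball ennreal_mult_less_top)
  finally show ?thesis .
qed

lemma ordered_energy_first:
  fixes u :: "'a::euclidean_space \<Rightarrow> real"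
  assumes [measurable]: "u \<in> borel_measurable borel" and e: "norm (e::'a) = 1"
  shows "ordered_energy s l (\<lambda>x y. ennreal \<bar>u x\<bar>) = outer_mass s l e * hardy s u"
proof -
  have "ordered_energy s l (\<lambda>x y. ennreal \<bar>u x\<bar>)
     = (\<integral>\<^sup>+ x. (\<integral>\<^sup>+ y. indicator {x. l * norm x < norm y} x * ennreal \<bar>u x\<bar> * ennreal (kernel s (x - y)) \<partial>lborel) \<partial>lborel)"
    by (rule ordered_energy_Fubini) measurable
  also have "\<dots> = (\<integral>\<^sup>+ x. outer_mass s l e * ennreal (\<bar>u x\<bar> * norm x powr (- s)) \<partial>lborel)"
  proof (rule nn_integral_cong_AE, rule AE_mp[OF AE_lborel_singleton[of "0::'a"]], rule AE_I2, rule impI)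
    fix x :: 'a assume "x \<noteq> 0"
    have "(\<integral>\<^sup>+ y. indicator {x. l * norm x < norm y} x * ennreal \<bar>u x\<bar> * ennreal (kernel s (x - y)) \<partial>lborel)
       = ennreal \<bar>u x\<bar> * outer_mass s l x"
      unfolding outer_mass_def by (subst nn_integral_cmult[symmetric]) (auto simp: mult_ac)
    also have "\<dots> = outer_mass s l e * ennreal (\<bar>u x\<bar> * norm x powr (- s))"
      by (simp add: outer_mass_homogeneous[OF e \<open>x \<noteq> 0\<close>] ennreal_mult mult_ac)
    finally show "(\<integral>\<^sup>+ y. indicator {x. l * norm x < norm y} x * ennreal \<bar>u x\<bar> * ennreal (kernel s (x - y)) \<partial>lborel)
       = outer_mass s l e * ennreal (\<bar>u x\<bar> * norm x powr (- s))" .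
  qed
  also have "\<dots> = outer_mass s l e * hardy s u"
    unfolding hardy_def by (rule nn_integral_cmult) measurable
  finally show ?thesis .
qed

lemma ordered_energy_second:
  fixes u :: "'a::euclidean_space \<Rightarrow> real"
  assumes [measurable]: "u \<in> borel_measurable borel" and e: "norm (e::'a) = 1"
  shows "ordered_energy s l (\<lambda>x y. ennreal \<bar>u y\<bar>) = inner_mass s l e * hardy s u"
proof -
  have "ordered_energy s l (\<lambda>x y. ennreal \<bar>u y\<bar>) = (\<integral>\<^sup>+ y. inner_mass s l e * ennreal (\<bar>u y\<bar> * norm y powr (- s)) \<partial>lborel)"
    unfolding ordered_energy_def
  proof (rule nn_integral_cong_AE, rule AE_mp[OF AE_lborel_singleton[of "0::'a"]], rule AE_I2, rule impI)
    fix y :: 'a assume "y \<noteq> 0"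
    have "(\<integral>\<^sup>+ x. indicator {x. l * norm x < norm y} x * ennreal \<bar>u y\<bar> * ennreal (kernel s (x - y)) \<partial>lborel)
       = ennreal \<bar>u y\<bar> * inner_mass s l y"
      unfolding inner_mass_def by (subst nn_integral_cmult[symmetric]) (auto simp: mult_ac)
    also have "\<dots> = inner_mass s l e * ennreal (\<bar>u y\<bar> * norm y powr (- s))"
      by (simp add: inner_mass_homogeneous[OF e \<open>y \<noteq> 0\<close>] ennreal_mult mult_ac)
    finally show "(\<integral>\<^sup>+ x. indicator {x. l * norm x < norm y} x * ennreal \<bar>u y\<bar> * ennreal (kernel s (x - y)) \<partial>lborel)
       = inner_mass s l e * ennreal (\<bar>u y\<bar> * norm y powr (- s))" .
  qed
  also have "\<dots> = inner_mass s l e * hardy s u"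
    unfolding hardy_def by (rule nn_integral_cmult) measurable
  finally show ?thesis .
qed

abbreviation increment :: "('a \<Rightarrow> real) \<Rightarrow> 'a \<Rightarrow> 'a \<Rightarrow> ennreal" where
  "increment u \<equiv> \<lambda>x y. ennreal \<bar>u x - u y\<bar>"

text \<open>The defect in the triangle inequality \<open>|u(x)| \<le> |u(x) - u(y)| + |u(y)|\<close>.\<close>

abbreviation slack :: "('a \<Rightarrow> real) \<Rightarrow> 'a \<Rightarrow> 'a \<Rightarrow> ennreal" where
  "slack u \<equiv> \<lambda>x y. ennreal (\<bar>u x - u y\<bar> + \<bar>u y\<bar> - \<bar>u x\<bar>)"

text \<open>The definition of the slack, rearranged so that both sides are sums of non-negative terms, and
integrated. The two terms without differences of \<open>u\<close> become multiples of the Hardy integral by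
homogeneity of the kernel masses.\<close>

lemma ordered_energy_balance:
  fixes u :: "'a::euclidean_space \<Rightarrow> real"
  assumes [measurable]: "u \<in> borel_measurable borel" and e: "norm (e::'a) = 1"
  shows "outer_mass s l e * hardy s u + ordered_energy s l (slack u)
    = ordered_energy s l (increment u) + inner_mass s l e * hardy s u"
proof -
  have "ordered_energy s l (\<lambda>x y. ennreal \<bar>u x\<bar>) + ordered_energy s l (slack u)
      = ordered_energy s l (\<lambda>x y. ennreal \<bar>u x\<bar> + slack u x y)"
    by (rule ordered_energy_add[symmetric]) measurable
  also have "\<dots> = ordered_energy s l (\<lambda>x y. increment u x y + ennreal \<bar>u y\<bar>)"
    by (rule ordered_energy_cong) (simp add: ennreal_plus[symmetric] del: ennreal_plus)
  also have "\<dots> = ordered_energy s l (increment u) + ordered_energy s l (\<lambda>x y. ennreal \<bar>u y\<bar>)"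
    by (rule ordered_energy_add) measurable
  finally show ?thesis using e by (simp add: ordered_energy_first ordered_energy_second)
qed

section \<open>The sharp constant and the fractional Hardy identity\<close>

lemma hardy_gaussian:
  fixes s :: real
  assumes "s < DIM('a)"
  shows "hardy s (gaussian :: 'a::euclidean_space \<Rightarrow> real) = ennreal (sphere_area TYPE('a) * (Gamma ((DIM('a) - s) / 2) / 2))"
proof -
  have "hardy s (gaussian :: 'a \<Rightarrow> real) = (\<integral>\<^sup>+ x. ennreal (norm x powr (- s) * exp (- (norm x)\<^sup>2)) \<partial>(lborel :: 'a measure))"
    unfolding hardy_def by (simp add: gaussian_def mult.commute)
  with weighted_gaussian_integral[OF assms] show ?thesis by simp
qed

text \<open>With \<open>q = x - y\<close> in place of \<open>x\<close>, the integral over \<open>y\<close> is a slab integral in one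
variable \<open>v\<close> with \<open>2 |v| < |q|\<close>. Interchanging \<open>q\<close> and \<open>v\<close> leaves the tail
of the kernel beyond radius \<open>2 |v|\<close>, and then a Gamma integral in \<open>v\<close>.\<close>

lemma gaussian_ordered_energy:
  assumes "0 < s" "s < 1"
  shows "ordered_energy s 1 (increment (gaussian :: 'a::euclidean_space \<Rightarrow> real))
    = ennreal (pi powr ((DIM('a) - 1) / 2) * (sphere_area TYPE('a) * (2 powr (- s) / s)) * Gamma ((1 - s) / 2))"
proof -
  let ?P = "ennreal (pi powr ((DIM('a) - 1) / 2))"
  let ?A = "sphere_area TYPE('a)"
  have "ordered_energy s 1 (increment (gaussian :: 'a \<Rightarrow> real))
     = (\<integral>\<^sup>+ (y::'a). (\<integral>\<^sup>+ q. indicator {y. norm (y + q) < norm y} y * ennreal (gaussian (y + q) - gaussian y) * ennreal (kernel s q) \<partial>lborel) \<partial>lborel)"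
    unfolding ordered_energy_def
  proof (rule nn_integral_cong)
    fix y :: 'a
    have "(\<integral>\<^sup>+ x. indicator {x. 1 * norm x < norm y} x * increment gaussian x y * ennreal (kernel s (x - y)) \<partial>lborel)
      = (\<integral>\<^sup>+ q. indicator {x. 1 * norm x < norm y} (q + y) * increment gaussian (q + y) y * ennreal (kernel s (q + y - y)) \<partial>lborel)"
      by (rule nn_integral_lborel_translate[symmetric]) measurable
    also have "\<dots> = (\<integral>\<^sup>+ q. indicator {y. norm (y + q) < norm y} y * ennreal (gaussian (y + q) - gaussian y) * ennreal (kernel s q) \<partial>lborel)"
    proof (rule nn_integral_cong)
      fix q :: 'a
      have "gaussian y \<le> gaussian (y + q)" if "norm (y + q) < norm y"
        using that by (auto simp: gaussian_def intro!: power_mono)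
      then show "indicator {x. 1 * norm x < norm y} (q + y) * increment gaussian (q + y) y * ennreal (kernel s (q + y - y))
        = indicator {y. norm (y + q) < norm y} y * ennreal (gaussian (y + q) - gaussian y) * ennreal (kernel s q)"
        by (auto simp: add.commute split: split_indicator)
    qed
    finally show "(\<integral>\<^sup>+ x. indicator {x. 1 * norm x < norm y} x * increment gaussian x y * ennreal (kernel s (x - y)) \<partial>lborel)
      = (\<integral>\<^sup>+ q. indicator {y. norm (y + q) < norm y} y * ennreal (gaussian (y + q) - gaussian y) * ennreal (kernel s q) \<partial>lborel)" .
  qed
  also have "\<dots> = (\<integral>\<^sup>+ q. (\<integral>\<^sup>+ (y::'a). indicator {y. norm (y + q) < norm y} y * ennreal (gaussian (y + q) - gaussian y) * ennreal (kernel s q) \<partial>lborel) \<partial>lborel)"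
    by (rule lborel_pair.Fubini') measurable
  also have "\<dots> = (\<integral>\<^sup>+ (q::'a). ?P * (\<integral>\<^sup>+ (v::real). ennreal (exp (- v\<^sup>2)) * (ennreal (kernel s q) * indicator {q. 2 * \<bar>v\<bar> < norm q} q) \<partial>lborel) \<partial>lborel)"
  proof (rule nn_integral_cong)
    fix q :: 'a
    have "(\<integral>\<^sup>+ (y::'a). indicator {y. norm (y + q) < norm y} y * ennreal (gaussian (y + q) - gaussian y) * ennreal (kernel s q) \<partial>lborel)
       = (\<integral>\<^sup>+ (y::'a). indicator {y. norm (y + q) < norm y} y * ennreal (gaussian (y + q) - gaussian y) \<partial>lborel) * ennreal (kernel s q)"
      by (rule nn_integral_multc) measurable
    also have "\<dots> = ?P * ((\<integral>\<^sup>+ (v::real). indicator {v. \<bar>v\<bar> < norm q / 2} v * ennreal (exp (- v\<^sup>2)) \<partial>lborel) * ennreal (kernel s q))"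
      by (simp add: gaussian_increment mult.assoc)
    also have "(\<integral>\<^sup>+ (v::real). indicator {v. \<bar>v\<bar> < norm q / 2} v * ennreal (exp (- v\<^sup>2)) \<partial>lborel) * ennreal (kernel s q)
       = (\<integral>\<^sup>+ (v::real). indicator {v. \<bar>v\<bar> < norm q / 2} v * ennreal (exp (- v\<^sup>2)) * ennreal (kernel s q) \<partial>lborel)"
      by (rule nn_integral_multc[symmetric]) measurable
    also have "\<dots> = (\<integral>\<^sup>+ (v::real). ennreal (exp (- v\<^sup>2)) * (ennreal (kernel s q) * indicator {q. 2 * \<bar>v\<bar> < norm q} q) \<partial>lborel)"
      by (intro nn_integral_cong) (auto simp: mult_ac split: split_indicator)
    finally show "(\<integral>\<^sup>+ (y::'a). indicator {y. norm (y + q) < norm y} y * ennreal (gaussian (y + q) - gaussian y) * ennreal (kernel s q) \<partial>lborel)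
      = ?P * (\<integral>\<^sup>+ (v::real). ennreal (exp (- v\<^sup>2)) * (ennreal (kernel s q) * indicator {q. 2 * \<bar>v\<bar> < norm q} q) \<partial>lborel)" .
  qed
  also have "\<dots> = ?P * (\<integral>\<^sup>+ (q::'a). (\<integral>\<^sup>+ (v::real). ennreal (exp (- v\<^sup>2)) * (ennreal (kernel s q) * indicator {q. 2 * \<bar>v\<bar> < norm q} q) \<partial>lborel) \<partial>lborel)"
    by (rule nn_integral_cmult) measurable
  also have "(\<integral>\<^sup>+ (q::'a). (\<integral>\<^sup>+ (v::real). ennreal (exp (- v\<^sup>2)) * (ennreal (kernel s q) * indicator {q. 2 * \<bar>v\<bar> < norm q} q) \<partial>lborel) \<partial>lborel)
     = (\<integral>\<^sup>+ (v::real). (\<integral>\<^sup>+ (q::'a). ennreal (exp (- v\<^sup>2)) * (ennreal (kernel s q) * indicator {q. 2 * \<bar>v\<bar> < norm q} q) \<partial>lborel) \<partial>lborel)"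
    by (rule lborel_pair.Fubini') measurable
  also have "\<dots> = (\<integral>\<^sup>+ (v::real). ennreal (?A * (2 powr (- s) / s)) * ennreal (norm v powr (- s) * exp (- (norm v)\<^sup>2)) \<partial>lborel)"
  proof (rule nn_integral_cong_AE, rule AE_mp[OF AE_lborel_singleton[of "0::real"]], rule AE_I2, rule impI)
    fix v :: real assume "v \<noteq> 0"
    have "(\<integral>\<^sup>+ (q::'a). ennreal (exp (- v\<^sup>2)) * (ennreal (kernel s q) * indicator {q. 2 * \<bar>v\<bar> < norm q} q) \<partial>lborel)
      = ennreal (exp (- v\<^sup>2)) * (\<integral>\<^sup>+ (q::'a). ennreal (kernel s q) * indicator {q. 2 * \<bar>v\<bar> < norm q} q \<partial>lborel)"
      by (rule nn_integral_cmult) measurable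
    also have "\<dots> = ennreal (exp (- v\<^sup>2)) * ennreal (?A * ((2 * \<bar>v\<bar>) powr (- s) / s))"
      unfolding kernel_def using \<open>v \<noteq> 0\<close> assms by (subst kernel_tail) auto
    also have "\<dots> = ennreal (?A * (2 powr (- s) / s)) * ennreal (norm v powr (- s) * exp (- (norm v)\<^sup>2))"
      using sphere_area_pos[where 'a='a] assms by (simp add: ennreal_mult[symmetric] powr_mult mult_ac)
    finally show "(\<integral>\<^sup>+ (q::'a). ennreal (exp (- v\<^sup>2)) * (ennreal (kernel s q) * indicator {q. 2 * \<bar>v\<bar> < norm q} q) \<partial>lborel)
      = ennreal (?A * (2 powr (- s) / s)) * ennreal (norm v powr (- s) * exp (- (norm v)\<^sup>2))" .
  qed
  also have "\<dots> = ennreal (?A * (2 powr (- s) / s)) * (\<integral>\<^sup>+ (v::real). ennreal (norm v powr (- s) * exp (- (norm v)\<^sup>2)) \<partial>lborel)"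
    by (rule nn_integral_cmult) measurable
  also have "(\<integral>\<^sup>+ (v::real). ennreal (norm v powr (- s) * exp (- (norm v)\<^sup>2)) \<partial>lborel) = ennreal (Gamma ((1 - s) / 2))"
    using assms by (subst weighted_gaussian_integral) (auto simp: sphere_area_real)
  finally show ?thesis
    using sphere_area_pos[where 'a='a] assms by (simp add: ennreal_mult'[symmetric] ennreal_mult[symmetric] mult_ac)
qed

lemma slack_gaussian: "ordered_energy s l (slack (gaussian :: 'a::euclidean_space \<Rightarrow> real)) = 0" if "l \<ge> 1"
proof -
  have "ordered_energy s l (slack (gaussian :: 'a \<Rightarrow> real)) = ordered_energy s l (\<lambda>(x::'a) y. 0)"
  proof (rule ordered_energy_cong)
    fix x y :: 'a assume "l * norm x < norm y"
    moreover have "1 * norm x \<le> l * norm x" using that by (intro mult_right_mono) auto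
    ultimately have "gaussian y \<le> gaussian x"
      by (auto simp: gaussian_def intro!: power_mono)
    then show "slack gaussian x y = 0"
      using gaussian_pos[of x] gaussian_pos[of y] by simp
  qed
  then show ?thesis by (simp add: ordered_energy_def)
qed

text \<open>The balance for \<open>u\<close>, multiplied by the Hardy integral of the Gaussian, minus the balance for the
Gaussian, multiplied by the Hardy integral of \<open>u\<close>. The outer masses drop out; the inner masses cancel
because they are finite, and this is where \<open>l > 1\<close> enters.\<close>

lemma ordered_energy_gaussian_comparison:
  fixes u :: "'a::euclidean_space \<Rightarrow> real"
  assumes u [measurable]: "u \<in> borel_measurable borel" and fin: "hardy s u < \<infinity>"
    and s: "0 < s" "s < 1" and l: "l > 1"
  shows "ordered_energy s l (increment (gaussian :: 'a \<Rightarrow> real)) * hardy s u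
      + hardy s (gaussian :: 'a \<Rightarrow> real) * ordered_energy s l (slack u)
    = hardy s (gaussian :: 'a \<Rightarrow> real) * ordered_energy s l (increment u)"
proof -
  obtain e :: 'a where "e \<in> Basis" using nonempty_Basis by blast
  then have e: "norm e = 1" by simp
  let ?g = "gaussian :: 'a \<Rightarrow> real"
  let ?o = "outer_mass s l e" and ?i = "inner_mass s l e"
  have "s < DIM('a)" using s DIM_positive[where 'a='a] by linarith
  then have g_fin: "hardy s ?g < \<infinity>" by (simp add: hardy_gaussian)
  have g: "?o * hardy s ?g = ordered_energy s l (increment ?g) + ?i * hardy s ?g"
    using ordered_energy_balance[OF gaussian_measurable e, of s l] l by (simp add: slack_gaussian)
  \<comment> \<open>Both balances are combined additively, since subtraction in the extended half-line is truncated.\<close>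
  have "?i * hardy s ?g * hardy s u + (ordered_energy s l (increment ?g) * hardy s u + hardy s ?g * ordered_energy s l (slack u))
      = ?o * hardy s ?g * hardy s u + hardy s ?g * ordered_energy s l (slack u)"
    by (simp add: g ring_distribs add_ac)
  also have "\<dots> = hardy s ?g * (?o * hardy s u + ordered_energy s l (slack u))"
    by (simp add: ring_distribs mult_ac)
  also have "\<dots> = hardy s ?g * (ordered_energy s l (increment u) + ?i * hardy s u)"
    by (simp only: ordered_energy_balance[OF u e])
  also have "\<dots> = ?i * hardy s ?g * hardy s u + hardy s ?g * ordered_energy s l (increment u)"
    by (simp add: ring_distribs mult_ac add_ac)
  finally have eq: "?i * hardy s ?g * hardy s u + (ordered_energy s l (increment ?g) * hardy s u + hardy s ?g * ordered_energy s l (slack u))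
      = ?i * hardy s ?g * hardy s u + hardy s ?g * ordered_energy s l (increment u)" .
  have "?i * hardy s ?g * hardy s u < \<infinity>"
    using inner_mass_finite[OF e l s(1)] g_fin fin by (simp add: ennreal_mult_less_top)
  with eq show ?thesis by (auto simp: ennreal_add_left_cancel)
qed

lemma incseq_ordered_energy: "incseq (\<lambda>n. ordered_energy s (threshold n) G)"
  by (auto simp: incseq_def intro!: ordered_energy_mono threshold_decseq)

lemma incseq_mult_ennreal: "incseq f \<Longrightarrow> incseq (\<lambda>n. c * f n)" for c :: ennreal
  by (auto simp: incseq_def intro!: mult_left_mono)

text \<open>Monotone convergence as \<open>l\<close> decreases to \<open>1\<close>: all energies in the comparison are monotone in \<open>l\<close>.\<close>

lemma ordered_energy_comparison_limit:
  fixes u :: "'a::euclidean_space \<Rightarrow> real"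
  assumes u [measurable]: "u \<in> borel_measurable borel" and fin: "hardy s u < \<infinity>"
    and s: "0 < s" "s < 1"
  shows "ordered_energy s 1 (increment (gaussian :: 'a \<Rightarrow> real)) * hardy s u
      + hardy s (gaussian :: 'a \<Rightarrow> real) * ordered_energy s 1 (slack u)
    = hardy s (gaussian :: 'a \<Rightarrow> real) * ordered_energy s 1 (increment u)"
proof -
  let ?g = "gaussian :: 'a \<Rightarrow> real"
  have "ordered_energy s 1 (increment ?g) * hardy s u + hardy s ?g * ordered_energy s 1 (slack u)
      = (SUP n. hardy s u * ordered_energy s (threshold n) (increment ?g)) + (SUP n. hardy s ?g * ordered_energy s (threshold n) (slack u))"
    by (simp add: ordered_energy_SUP SUP_mult_left_ennreal mult.commute[of _ "hardy s u"])
  also have "\<dots> = (SUP n. hardy s u * ordered_energy s (threshold n) (increment ?g) + hardy s ?g * ordered_energy s (threshold n) (slack u))"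
    by (rule ennreal_SUP_add[symmetric]) (intro incseq_mult_ennreal incseq_ordered_energy)+
  also have "\<dots> = (SUP n. hardy s ?g * ordered_energy s (threshold n) (increment u))"
    using ordered_energy_gaussian_comparison[OF u fin s threshold_gt_1] by (simp add: mult.commute[of "hardy s u"])
  also have "\<dots> = hardy s ?g * ordered_energy s 1 (increment u)"
    by (simp add: ordered_energy_SUP SUP_mult_left_ennreal)
  finally show ?thesis .
qed

definition sharp_const :: "real \<Rightarrow> nat \<Rightarrow> real" where
  "sharp_const s n = 4 / s * (pi powr (n / 2) * Gamma (1 - s) / (Gamma ((n - s) / 2) * Gamma (1 - s / 2)))"

text \<open>The complex duplication formula, read off on the positive real axis.\<close>

lemma Gamma_legendre_duplication_real:
  fixes x :: real
  assumes "x > 0"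
  shows "Gamma x * Gamma (x + 1/2) = 2 powr (1 - 2 * x) * sqrt pi * Gamma (2 * x)"
proof -
  have "complex_of_real x \<notin> \<int>\<^sub>\<le>\<^sub>0" "complex_of_real x + 1/2 \<notin> \<int>\<^sub>\<le>\<^sub>0"
    using assms by (auto elim!: nonpos_Ints_cases simp: complex_eq_iff)
  from Gamma_legendre_duplication[OF this]
  have "complex_of_real (Gamma x * Gamma (x + 1/2)) = complex_of_real (exp ((1 - 2 * x) * ln 2) * sqrt pi * Gamma (2 * x))"
    by (simp add: Gamma_complex_of_real[symmetric] exp_of_real[symmetric])
  then show ?thesis by (simp only: of_real_eq_iff powr_def) simp
qed

lemma sharp_const_pos:
  assumes "0 < s" "s < 1" "n > 0"
  shows "sharp_const s n > 0"
proof -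
  have "s < real n" using assms by linarith
  then show ?thesis using assms by (auto simp: sharp_const_def intro!: divide_pos_pos mult_pos_pos Gamma_real_pos)
qed

text \<open>Both quantities are known; Legendre duplication at \<open>(1 - s) / 2\<close> turns
\<open>\<Gamma>((1 - s) / 2)\<close> into the quotient \<open>\<Gamma>(1 - s) / \<Gamma>(1 - s / 2)\<close> of the sharp constant.\<close>

lemma gaussian_quotient:
  assumes s: "0 < s" "s < 1"
  shows "ordered_energy s 1 (increment (gaussian :: 'a::euclidean_space \<Rightarrow> real))
    = ennreal (sharp_const s DIM('a) / 2) * hardy s (gaussian :: 'a \<Rightarrow> real)"
proof -
  have sn: "s < DIM('a)" using s DIM_positive[where 'a='a] by linarith
  have pos: "Gamma ((DIM('a) - s) / 2) > 0" "Gamma (1 - s / 2) > 0"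
    using s sn by (auto intro!: Gamma_real_pos)
  have "Gamma ((1 - s) / 2) * Gamma (1 - s / 2) = 2 powr s * sqrt pi * Gamma (1 - s)"
  proof -
    have "2 * ((1 - s) / 2) = 1 - s" "(1 - s) / 2 + 1 / 2 = 1 - s / 2" "1 - (1 - s) = s"
      by (simp_all add: field_simps)
    then show ?thesis
      using Gamma_legendre_duplication_real[of "(1 - s) / 2"] s by (simp only:)
  qed
  then have dup: "Gamma ((1 - s) / 2) = 2 powr s * sqrt pi * Gamma (1 - s) / Gamma (1 - s / 2)"
    using pos by (simp add: field_simps)
  have pw: "pi powr ((DIM('a) - 1) / 2) * sqrt pi = pi powr (DIM('a) / 2)"
    by (simp add: powr_half_sqrt[symmetric] powr_add[symmetric] field_simps del: powr_half_sqrt)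
  have tw: "2 powr (- s) * 2 powr s = (1::real)" by (simp add: powr_add[symmetric])
  have "pi powr ((DIM('a) - 1) / 2) * (sphere_area TYPE('a) * (2 powr (- s) / s)) * Gamma ((1 - s) / 2)
     = sphere_area TYPE('a) / s * (2 powr (- s) * 2 powr s) * (pi powr ((DIM('a) - 1) / 2) * sqrt pi) * Gamma (1 - s) / Gamma (1 - s / 2)"
    unfolding dup by (simp add: mult_ac)
  also have "\<dots> = sharp_const s DIM('a) / 2 * (sphere_area TYPE('a) * (Gamma ((DIM('a) - s) / 2) / 2))"
    unfolding tw pw using pos s by (simp add: sharp_const_def field_simps)
  finally have eq: "pi powr ((DIM('a) - 1) / 2) * (sphere_area TYPE('a) * (2 powr (- s) / s)) * Gamma ((1 - s) / 2)
     = sharp_const s DIM('a) / 2 * (sphere_area TYPE('a) * (Gamma ((DIM('a) - s) / 2) / 2))" .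
  show ?thesis
    unfolding gaussian_ordered_energy[OF s] hardy_gaussian[OF sn] eq
    using sharp_const_pos[OF s DIM_positive[where 'a='a]] by (intro ennreal_mult') simp
qed

lemma ordered_energy_identity:
  fixes u :: "'a::euclidean_space \<Rightarrow> real"
  assumes u: "u \<in> borel_measurable borel" and fin: "hardy s u < \<infinity>"
    and s: "0 < s" "s < 1"
  shows "ordered_energy s 1 (increment u) = ennreal (sharp_const s DIM('a) / 2) * hardy s u + ordered_energy s 1 (slack u)"
proof -
  let ?H = "hardy s (gaussian :: 'a \<Rightarrow> real)"
  have sn: "s < DIM('a)" using s DIM_positive[where 'a='a] by linarith
  have "?H * (ennreal (sharp_const s DIM('a) / 2) * hardy s u + ordered_energy s 1 (slack u))
      = ?H * ordered_energy s 1 (increment u)"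
    using ordered_energy_comparison_limit[OF u fin s]
    by (simp add: gaussian_quotient[OF s] ring_distribs mult_ac)
  moreover have "Gamma ((DIM('a) - s) / 2) > 0" using sn by (intro Gamma_real_pos) simp
  then have "0 < ?H" "?H < \<infinity>"
    using sphere_area_pos[where 'a='a] by (auto simp: hardy_gaussian[OF sn])
  ultimately show ?thesis by (auto simp: ennreal_mult_cancel_left)
qed

text \<open>The Gagliardo seminorm as an integral over Borel measure, written with the kernel as a factor: in this form
Tonelli's theorem applies to Borel functions.\<close>

definition energy :: "real \<Rightarrow> ('a::euclidean_space \<Rightarrow> real) \<Rightarrow> ennreal" where
  "energy s u = (\<integral>\<^sup>+ y. (\<integral>\<^sup>+ x. increment u x y * ennreal (kernel s (x - y)) \<partial>lborel) \<partial>lborel)"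

lemma AE_norm_neq: "AE x in lborel. norm (x::'a::euclidean_space) \<noteq> r"
proof -
  have "negligible (sphere (0::'a) r)" by (rule negligible_sphere)
  then have "sphere (0::'a) r \<in> null_sets lborel"
    by (auto simp: null_sets_completion_iff negligible_iff_null_sets)
  from AE_not_in[OF this] show ?thesis by eventually_elim simp
qed

text \<open>By symmetry of the kernel, exchanging \<open>x\<close> and \<open>y\<close> carries the pairs with \<open>|x| > |y|\<close> to those with
\<open>|x| < |y|\<close>; for fixed \<open>y\<close> the points with \<open>|x| = |y|\<close> form a sphere, which is a null set.\<close>

lemma energy_eq_ordered_energy:
  fixes u :: "'a::euclidean_space \<Rightarrow> real"
  assumes [measurable]: "u \<in> borel_measurable borel"
  shows "energy s u = 2 * ordered_energy s 1 (increment u)"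
proof -
  let ?k = "\<lambda>x y. increment u x y * ennreal (kernel s (x - y))"
  let ?i = "\<lambda>x y. indicator {x. 1 * norm x < norm y} x * increment u x y * ennreal (kernel s (x - y))"
  have "energy s u = (\<integral>\<^sup>+ y. (\<integral>\<^sup>+ x. ?i x y \<partial>lborel) + (\<integral>\<^sup>+ x. ?i y x \<partial>lborel) \<partial>lborel)"
    unfolding energy_def
  proof (rule nn_integral_cong)
    fix y
    have "(\<integral>\<^sup>+ x. ?k x y \<partial>lborel) = (\<integral>\<^sup>+ x. ?i x y + ?i y x \<partial>lborel)"
      by (rule nn_integral_cong_AE, rule AE_mp[OF AE_norm_neq[of "norm y"]], rule AE_I2)
        (auto simp: kernel_minus_commute abs_minus_commute split: split_indicator)
    also have "\<dots> = (\<integral>\<^sup>+ x. ?i x y \<partial>lborel) + (\<integral>\<^sup>+ x. ?i y x \<partial>lborel)"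
      by (rule nn_integral_add) measurable
    finally show "(\<integral>\<^sup>+ x. ?k x y \<partial>lborel) = (\<integral>\<^sup>+ x. ?i x y \<partial>lborel) + (\<integral>\<^sup>+ x. ?i y x \<partial>lborel)" .
  qed
  also have "\<dots> = (\<integral>\<^sup>+ y. (\<integral>\<^sup>+ x. ?i x y \<partial>lborel) \<partial>lborel) + (\<integral>\<^sup>+ y. (\<integral>\<^sup>+ x. ?i y x \<partial>lborel) \<partial>lborel)"
    by (rule nn_integral_add) measurable
  also have "(\<integral>\<^sup>+ y. (\<integral>\<^sup>+ x. ?i y x \<partial>lborel) \<partial>lborel) = ordered_energy s 1 (increment u)"
    by (rule ordered_energy_Fubini[symmetric]) measurable
  also have "(\<integral>\<^sup>+ y. (\<integral>\<^sup>+ x. ?i x y \<partial>lborel) \<partial>lborel) = ordered_energy s 1 (increment u)"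
    by (simp add: ordered_energy_def)
  finally show ?thesis by (simp add: mult_2)
qed

theorem fractional_hardy_identity:
  fixes u :: "'a::euclidean_space \<Rightarrow> real"
  assumes u: "u \<in> borel_measurable borel" and fin: "hardy s u < \<infinity>"
    and s: "0 < s" "s < 1"
  shows "energy s u = ennreal (sharp_const s DIM('a)) * hardy s u + 2 * ordered_energy s 1 (slack u)"
proof -
  have "2 * ennreal (sharp_const s DIM('a) / 2) = ennreal (sharp_const s DIM('a))"
    using ennreal_mult'[of 2 "sharp_const s DIM('a) / 2"] by simp
  then show ?thesis
    by (simp add: energy_eq_ordered_energy[OF u] ordered_energy_identity[OF u fin s] ring_distribs mult.assoc[symmetric])
qed

section \<open>Borel representatives and finiteness of the Hardy integral\<close>

lemma gagliardo_eq_energy: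
  fixes u v :: "'a::euclidean_space \<Rightarrow> real"
  assumes ae: "AE x in lborel. u x = v x"
  shows "gagliardo s u = energy s v"
proof -
  have "gagliardo s u = (\<integral>\<^sup>+ y. (\<integral>\<^sup>+ x. increment u x y * ennreal (kernel s (x - y)) \<partial>lborel) \<partial>lborel)"
  proof -
    have "\<bar>u x - u y\<bar> / norm (x - y) powr (real DIM('a) + s) = \<bar>u x - u y\<bar> * kernel s (x - y)" for x y
      unfolding kernel_def powr_minus_divide by simp
    then show ?thesis unfolding gagliardo_def nn_integral_completion by (simp add: ennreal_mult)
  qed
  also have "\<dots> = energy s v"
    unfolding energy_def
  proof (rule nn_integral_cong_AE, rule AE_mp[OF ae], rule AE_I2, rule impI)
    fix y assume y: "u y = v y"
    show "(\<integral>\<^sup>+ x. increment u x y * ennreal (kernel s (x - y)) \<partial>lborel) = (\<integral>\<^sup>+ x. increment v x y * ennreal (kernel s (x - y)) \<partial>lborel)"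
      by (rule nn_integral_cong_AE, rule AE_mp[OF ae], rule AE_I2) (simp add: y)
  qed
  finally show ?thesis .
qed

lemma hardy_integral_eq_hardy:
  fixes u v :: "'a::euclidean_space \<Rightarrow> real"
  assumes ae: "AE x in lborel. u x = v x"
  shows "hardy_integral s u = hardy s v"
proof -
  have "hardy_integral s u = (\<integral>\<^sup>+ x. ennreal (\<bar>u x\<bar> * norm x powr (- s)) \<partial>lborel)"
    unfolding hardy_integral_def nn_integral_completion
    by (intro nn_integral_cong) (simp add: powr_minus divide_inverse)
  also have "\<dots> = hardy s v"
    unfolding hardy_def by (rule nn_integral_cong_AE, rule AE_mp[OF ae], rule AE_I2) simp
  finally show ?thesis .
qed

lemma weight_integrable_on_ball:
  assumes s: "0 < s" "s < 1"
  shows "(\<integral>\<^sup>+ x. ennreal (norm x powr (- s)) * indicator (cball 0 1) x \<partial>(lborel :: 'a::euclidean_space measure)) < \<infinity>"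
proof -
  have sn: "s < DIM('a)" using s DIM_positive[where 'a='a] by linarith
  have "(\<integral>\<^sup>+ x. ennreal (norm x powr (- s)) * indicator (cball 0 1) x \<partial>(lborel :: 'a measure))
     \<le> (\<integral>\<^sup>+ x. ennreal (exp 1) * ennreal (norm x powr (- s) * exp (- (norm x)\<^sup>2)) \<partial>(lborel :: 'a measure))"
  proof (rule nn_integral_mono)
    fix x :: 'a
    show "ennreal (norm x powr (- s)) * indicator (cball 0 1) x \<le> ennreal (exp 1) * ennreal (norm x powr (- s) * exp (- (norm x)\<^sup>2))"
    proof (cases "norm x \<le> 1")
      case True
      then have "(norm x)\<^sup>2 \<le> 1" by (simp add: power_le_one)
      then have "1 \<le> exp 1 * exp (- (norm x)\<^sup>2)" by (simp add: exp_add[symmetric])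
      then have "norm x powr (- s) * 1 \<le> norm x powr (- s) * (exp 1 * exp (- (norm x)\<^sup>2))"
        by (intro mult_left_mono) auto
      with True show ?thesis by (simp add: ennreal_mult'[symmetric] ennreal_leI mult_ac)
    qed simp
  qed
  also have "\<dots> = ennreal (exp 1) * (\<integral>\<^sup>+ x. ennreal (norm x powr (- s) * exp (- (norm x)\<^sup>2)) \<partial>(lborel :: 'a measure))"
    by (rule nn_integral_cmult) measurable
  also have "\<dots> < \<infinity>" by (simp add: weighted_gaussian_integral[OF sn] ennreal_mult_less_top)
  finally show ?thesis .
qed

text \<open>The weight is integrable on the unit ball because \<open>s < N\<close>, and it is at most \<open>1\<close> elsewhere.\<close>

lemma hardy_finite_bounded:
  fixes v :: "'a::euclidean_space \<Rightarrow> real"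
  assumes s: "0 < s" "s < 1" and [measurable]: "E \<in> sets borel" and E: "emeasure lborel E < \<infinity>"
    and bound: "\<And>x. \<bar>v x\<bar> \<le> M" and supp: "\<And>x. x \<notin> E \<Longrightarrow> v x = 0"
  shows "hardy s v < \<infinity>"
proof -
  have M: "M \<ge> 0" using bound[of 0] by linarith
  have [measurable]: "cball (0::'a) 1 \<in> sets borel" by simp
  have "hardy s v \<le> (\<integral>\<^sup>+ x. ennreal M * (ennreal (norm x powr (- s)) * indicator (cball 0 1) x + indicator E x) \<partial>lborel)"
    unfolding hardy_def
  proof (rule nn_integral_mono)
    fix x :: 'a
    show "ennreal (\<bar>v x\<bar> * norm x powr (- s)) \<le> ennreal M * (ennreal (norm x powr (- s)) * indicator (cball 0 1) x + indicator E x)"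
    proof (cases "norm x \<le> 1")
      case True
      have "\<bar>v x\<bar> * norm x powr (- s) \<le> M * norm x powr (- s)"
        using bound by (intro mult_right_mono) auto
      then have "ennreal (\<bar>v x\<bar> * norm x powr (- s)) \<le> ennreal M * ennreal (norm x powr (- s))"
        using M by (simp add: ennreal_mult'[symmetric] ennreal_leI)
      also have "\<dots> \<le> ennreal M * (ennreal (norm x powr (- s)) * indicator (cball 0 1) x + indicator E x)"
        using True by (intro mult_left_mono) auto
      finally show ?thesis .
    next
      case False
      then have "x \<noteq> 0" by auto
      with False have "norm x powr (- s) \<le> 1" using powr_mono[of "- s" 0 "norm x"] s by simp
      then have "\<bar>v x\<bar> * norm x powr (- s) \<le> M * 1"
        using bound M by (intro mult_mono) auto
      then show ?thesis using supp[of x] False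
        by (cases "x \<in> E") (auto simp: ennreal_leI)
    qed
  qed
  also have "\<dots> = ennreal M * (\<integral>\<^sup>+ x. (ennreal (norm x powr (- s)) * indicator (cball 0 1) x + indicator E x) \<partial>lborel)"
    by (rule nn_integral_cmult) measurable
  also have "\<dots> = ennreal M * ((\<integral>\<^sup>+ x. ennreal (norm x powr (- s)) * indicator (cball 0 1) x \<partial>(lborel :: 'a measure)) + (\<integral>\<^sup>+ x. indicator E x \<partial>lborel))"
    by (rule arg_cong[where f="\<lambda>z. ennreal M * z"], rule nn_integral_add) measurable
  also have "\<dots> < \<infinity>" using weight_integrable_on_ball[OF s, where 'a='a] E by (simp add: ennreal_mult_less_top)
  finally show ?thesis .
qed

lemma energy_mono:
  assumes "\<And>x y. \<bar>v x - v y\<bar> \<le> \<bar>u x - u y\<bar>"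
  shows "energy s v \<le> energy s u"
  unfolding energy_def by (intro nn_integral_mono mult_right_mono ennreal_leI assms) auto

text \<open>Lowering \<open>|u|\<close> by \<open>1 / (n + 1)\<close> and cutting the result at \<open>0\<close> and \<open>n\<close> does not increase the
seminorm. It produces bounded functions whose support has finite measure if the superlevel sets of \<open>|u|\<close> do.\<close>

definition truncate :: "('a \<Rightarrow> real) \<Rightarrow> nat \<Rightarrow> 'a \<Rightarrow> real" where
  "truncate u n x = min (max (\<bar>u x\<bar> - 1 / Suc n) 0) n"

lemma truncate_measurable [measurable]:
  assumes [measurable]: "u \<in> borel_measurable M"
  shows "truncate u n \<in> borel_measurable M"
  unfolding truncate_def by measurable

lemma truncate_lipschitz: "\<bar>truncate u n x - truncate u n y\<bar> \<le> \<bar>u x - u y\<bar>"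
  unfolding truncate_def by linarith

lemma truncate_nonneg: "0 \<le> truncate u n x" and truncate_le: "truncate u n x \<le> n"
  unfolding truncate_def by auto

lemma truncate_mono: "m \<le> n \<Longrightarrow> truncate u m x \<le> truncate u n x"
proof -
  assume "m \<le> n"
  then have "1 / real (Suc n) \<le> 1 / real (Suc m)" "real m \<le> real n" by (auto intro: frac_le)
  then show ?thesis unfolding truncate_def by linarith
qed

lemma truncate_tendsto: "(\<lambda>n. truncate u n x) \<longlonglongrightarrow> \<bar>u x\<bar>"
proof -
  have "(\<lambda>n. max (\<bar>u x\<bar> - 1 / Suc n) 0) \<longlonglongrightarrow> max (\<bar>u x\<bar> - 0) 0"
    by (intro tendsto_intros LIMSEQ_Suc lim_1_over_n)
  then have lim: "(\<lambda>n. max (\<bar>u x\<bar> - 1 / Suc n) 0) \<longlonglongrightarrow> \<bar>u x\<bar>" by simp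
  obtain n0 where n0: "\<bar>u x\<bar> \<le> real n0" using real_arch_simple by blast
  have "\<forall>\<^sub>F n in sequentially. max (\<bar>u x\<bar> - 1 / Suc n) 0 = truncate u n x"
  proof (rule eventually_sequentiallyI)
    fix n assume "n0 \<le> n"
    then have "\<bar>u x\<bar> \<le> real n" using n0 by linarith
    moreover have "0 \<le> 1 / real (Suc n)" by simp
    ultimately show "max (\<bar>u x\<bar> - 1 / Suc n) 0 = truncate u n x" unfolding truncate_def by linarith
  qed
  from Lim_transform_eventually[OF lim this] show ?thesis .
qed

lemma hardy_truncate_SUP:
  fixes u :: "'a::euclidean_space \<Rightarrow> real"
  assumes [measurable]: "u \<in> borel_measurable borel"
  shows "hardy s u = (SUP n. hardy s (truncate u n))"
proof -
  have inc: "incseq (\<lambda>n. ennreal (\<bar>truncate u n x\<bar> * norm x powr (- s)))" for x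
    using truncate_nonneg truncate_mono[of _ _ u x]
    by (auto simp: incseq_def abs_of_nonneg[OF truncate_nonneg] intro!: ennreal_leI mult_right_mono)
  have "(\<lambda>n. ennreal (\<bar>truncate u n x\<bar> * norm x powr (- s))) \<longlonglongrightarrow> ennreal (\<bar>\<bar>u x\<bar>\<bar> * norm x powr (- s))" for x
    by (intro tendsto_intros truncate_tendsto)
  then have "ennreal (\<bar>u x\<bar> * norm x powr (- s)) = (SUP n. ennreal (\<bar>truncate u n x\<bar> * norm x powr (- s)))" for x
    using LIMSEQ_unique[OF _ LIMSEQ_SUP[OF inc]] by simp
  then have "hardy s u = (\<integral>\<^sup>+ x. (SUP n. ennreal (\<bar>truncate u n x\<bar> * norm x powr (- s))) \<partial>lborel)"
    by (simp add: hardy_def)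
  also have "\<dots> = (SUP n. hardy s (truncate u n))"
    unfolding hardy_def
    by (intro nn_integral_monotone_convergence_SUP) (use inc in \<open>auto simp: incseq_def le_fun_def\<close>)
  finally show ?thesis .
qed

text \<open>The identity presupposes a finite Hardy integral, so it is applied to the truncations, and
monotone convergence transfers the inequality to \<open>u\<close>. In particular a finite
seminorm forces a finite Hardy integral.\<close>

lemma hardy_inequality_vanishing:
  fixes u :: "'a::euclidean_space \<Rightarrow> real"
  assumes u [measurable]: "u \<in> borel_measurable borel" and s: "0 < s" "s < 1"
    and levels: "\<And>t. t > 0 \<Longrightarrow> emeasure lborel {x. t < \<bar>u x\<bar>} < \<infinity>"
  shows "ennreal (sharp_const s DIM('a)) * hardy s u \<le> energy s u"
proof -
  have "ennreal (sharp_const s DIM('a)) * hardy s (truncate u n) \<le> energy s u" for n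
  proof -
    have "hardy s (truncate u n) < \<infinity>"
    proof (rule hardy_finite_bounded[OF s, where E="{x. 1 / Suc n < \<bar>u x\<bar>}" and M=n])
      show "\<bar>truncate u n x\<bar> \<le> real n" for x
        using truncate_nonneg[of u n x] truncate_le[of u n x] by simp
      show "truncate u n x = 0" if "x \<notin> {x. 1 / real (Suc n) < \<bar>u x\<bar>}" for x
        using that by (simp add: truncate_def)
      show "emeasure lborel {x. 1 / real (Suc n) < \<bar>u x\<bar>} < \<infinity>" by (rule levels) simp
    qed measurable
    then have "ennreal (sharp_const s DIM('a)) * hardy s (truncate u n) \<le> energy s (truncate u n)"
      using fractional_hardy_identity[OF _ _ s, of "truncate u n"] by simp
    also have "\<dots> \<le> energy s u" by (rule energy_mono[OF truncate_lipschitz])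
    finally show ?thesis .
  qed
  then show ?thesis
    by (simp add: hardy_truncate_SUP[OF u] SUP_mult_left_ennreal SUP_least)
qed

lemma finite_levels_of_power_integrable:
  fixes u :: "'a::euclidean_space \<Rightarrow> real"
  assumes [measurable]: "u \<in> borel_measurable borel" and "q > 0" "t > 0"
    and fin: "(\<integral>\<^sup>+ x. ennreal (\<bar>u x\<bar> powr q) \<partial>lborel) < \<infinity>"
  shows "emeasure lborel {x. t < \<bar>u x\<bar>} < \<infinity>"
proof -
  have "ennreal (t powr q) * emeasure lborel {x. t < \<bar>u x\<bar>} = (\<integral>\<^sup>+ x. ennreal (t powr q) * indicator {x. t < \<bar>u x\<bar>} x \<partial>lborel)"
    by (rule nn_integral_cmult_indicator[symmetric]) measurable
  also have "\<dots> \<le> (\<integral>\<^sup>+ x. ennreal (\<bar>u x\<bar> powr q) \<partial>lborel)"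
    using assms by (intro nn_integral_mono) (auto intro!: ennreal_leI powr_mono2 split: split_indicator)
  also note fin
  finally show ?thesis using \<open>t > 0\<close>
    by (auto simp: ennreal_mult_less_top ennreal_mult_eq_top_iff less_top)
qed

text \<open>Fubini's theorem for the product of Lebesgue measures is used on Borel functions, hence the passage to
a Borel representative. Integrability of the power \<open>N / (N - s)\<close> makes its superlevel sets have finite measure.\<close>

lemma homogeneous_W0_borel:
  fixes u :: "'a::euclidean_space \<Rightarrow> real"
  assumes "u \<in> homogeneous_W0 s" and s: "0 < s" "s < 1"
  obtains v where "v \<in> borel_measurable borel" "AE x in lborel. u x = v x" "hardy s v < \<infinity>"
proof -
  have sn: "s < DIM('a)" using s DIM_positive[where 'a='a] by linarith
  define q where "q = real DIM('a) / (real DIM('a) - s)"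
  have q: "q > 0" using sn by (simp add: q_def)
  have meas: "u \<in> borel_measurable lebesgue" and Lq: "(\<integral>\<^sup>+ x. ennreal (\<bar>u x\<bar> powr q) \<partial>lborel) < \<infinity>"
    and en: "gagliardo s u < \<infinity>"
    using assms(1) by (auto simp: homogeneous_W0_def nn_integral_completion q_def)
  obtain v where v: "v \<in> borel_measurable lborel" and ae: "AE x in lborel. u x = v x"
    using completion_ex_borel_measurable_real[OF meas] by blast
  have [measurable]: "v \<in> borel_measurable borel" using v by simp
  have "(\<integral>\<^sup>+ x. ennreal (\<bar>v x\<bar> powr q) \<partial>lborel) = (\<integral>\<^sup>+ x. ennreal (\<bar>u x\<bar> powr q) \<partial>lborel)"
    by (rule nn_integral_cong_AE, rule AE_mp[OF ae], rule AE_I2) simp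
  with Lq have "(\<integral>\<^sup>+ x. ennreal (\<bar>v x\<bar> powr q) \<partial>lborel) < \<infinity>" by simp
  then have "ennreal (sharp_const s DIM('a)) * hardy s v \<le> energy s v"
    using q s by (intro hardy_inequality_vanishing finite_levels_of_power_integrable) auto
  also have "\<dots> < \<infinity>" using en by (simp add: gagliardo_eq_energy[OF ae])
  finally have "hardy s v < \<infinity>"
    using sharp_const_pos[OF s DIM_positive[where 'a='a]]
    by (auto simp: ennreal_mult_less_top ennreal_mult_eq_top_iff less_top)
  from that[OF _ ae this] show ?thesis by simp
qed

section \<open>Vanishing slack characterises symmetric decreasing functions\<close>

lemma slack_energy_zero_iff:
  fixes u :: "'a::euclidean_space \<Rightarrow> real"
  assumes [measurable]: "u \<in> borel_measurable borel"
  shows "ordered_energy s 1 (slack u) = 0 \<longleftrightarrow>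
    (AE y in lborel. AE x in lborel. norm x < norm y \<longrightarrow> \<bar>u x - u y\<bar> + \<bar>u y\<bar> = \<bar>u x\<bar>)"
proof -
  have pt: "indicator {x. 1 * norm x < norm y} x * slack u x y * ennreal (kernel s (x - y)) = 0 \<longleftrightarrow>
      (norm x < norm y \<longrightarrow> \<bar>u x - u y\<bar> + \<bar>u y\<bar> = \<bar>u x\<bar>)" for x y
  proof (cases "norm x < norm y")
    case True
    then have "x - y \<noteq> 0" by auto
    then have "kernel s (x - y) > 0" by (simp add: kernel_def)
    moreover have "\<bar>u x\<bar> \<le> \<bar>u x - u y\<bar> + \<bar>u y\<bar>" by linarith
    ultimately show ?thesis using True by auto
  qed simp
  have "ordered_energy s 1 (slack u) = 0 \<longleftrightarrow>
    (AE y in lborel. (\<integral>\<^sup>+ x. indicator {x. 1 * norm x < norm y} x * slack u x y * ennreal (kernel s (x - y)) \<partial>lborel) = 0)"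
    unfolding ordered_energy_def by (rule nn_integral_0_iff_AE) measurable
  also have "\<dots> \<longleftrightarrow> (AE y in lborel. AE x in lborel. indicator {x. 1 * norm x < norm y} x * slack u x y * ennreal (kernel s (x - y)) = 0)"
  proof (intro AE_cong)
    fix y
    show "(\<integral>\<^sup>+ x. indicator {x. 1 * norm x < norm y} x * slack u x y * ennreal (kernel s (x - y)) \<partial>lborel) = 0
      \<longleftrightarrow> (AE x in lborel. indicator {x. 1 * norm x < norm y} x * slack u x y * ennreal (kernel s (x - y)) = 0)"
      by (rule nn_integral_0_iff_AE) measurable
  qed
  finally show ?thesis unfolding pt .
qed

lemma AE_obtains_in_ball:
  assumes "AE x in lborel. norm (x::'a::euclidean_space) < r \<longrightarrow> P x" "r > 0"
  obtains x where "norm x < r" "x \<noteq> 0" "P x"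
proof -
  have "\<not> (AE x in lborel. \<not> norm (x::'a) < r)"
  proof
    assume "AE x in lborel. \<not> norm (x::'a) < r"
    then have "AE x in lborel. x \<notin> ball (0::'a) r" by simp
    then have "ball (0::'a) r \<in> null_sets lborel" by (simp add: AE_iff_null_sets)
    then have "ennreal (unit_ball_vol (real DIM('a)) * r ^ DIM('a)) = 0"
      using \<open>r > 0\<close> by (simp add: null_sets_def emeasure_ball)
    moreover have "unit_ball_vol (real DIM('a)) * r ^ DIM('a) > 0"
      using \<open>r > 0\<close> by (intro mult_pos_pos) auto
    ultimately show False by (simp add: ennreal_eq_0_iff)
  qed
  moreover have "AE x in lborel. \<not> norm (x::'a) < r" if "\<not> (\<exists>x. norm x < r \<and> x \<noteq> 0 \<and> P x)"
    using assms(1) AE_lborel_singleton[of "0::'a"] by eventually_elim (use that in blast)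
  ultimately show ?thesis using that by blast
qed

definition essentially_exceeds :: "('a::euclidean_space \<Rightarrow> real) \<Rightarrow> real \<Rightarrow> real \<Rightarrow> bool" where
  "essentially_exceeds v t r \<longleftrightarrow> \<not> (AE y in lborel. r < norm y \<longrightarrow> v y \<le> t)"

lemma essentially_exceeds_antimono:
  assumes "essentially_exceeds v t r" "r' \<le> r"
  shows "essentially_exceeds v t r'"
  unfolding essentially_exceeds_def
proof
  assume "AE y in lborel. r' < norm y \<longrightarrow> v y \<le> t"
  then have "AE y in lborel. r < norm y \<longrightarrow> v y \<le> t"
    by eventually_elim (use assms(2) in auto)
  with assms(1) show False by (simp add: essentially_exceeds_def)
qed

text \<open>The radii beyond which \<open>v\<close> essentially exceeds \<open>t\<close> form an initial segment. For rational radii above its end,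
\<open>v\<close> is at most \<open>t\<close> almost everywhere beyond; for rational radii below, some generic point further
out has a value above \<open>t\<close>, which is a lower bound for \<open>v\<close> at almost every point inside. Countably many radii
decide every point, except on the sphere at the end of the segment, which is a null set.\<close>

lemma superlevel_set_ball:
  fixes v :: "'a::euclidean_space \<Rightarrow> real"
  assumes dec: "AE y in lborel. AE x in lborel. norm x < norm y \<longrightarrow> v y \<le> v x"
  shows "AE x in lborel. t < v x \<longleftrightarrow> essentially_exceeds v t (norm x)"
proof -
  define A where "A = {r. 0 \<le> r \<and> \<not> essentially_exceeds v t r}"
  have above: "AE x in lborel. \<forall>q::rat. \<not> essentially_exceeds v t (of_rat q) \<longrightarrow> of_rat q < norm x \<longrightarrow> v x \<le> t"
    unfolding AE_all_countable
  proof
    fix q :: rat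
    show "AE x in lborel. \<not> essentially_exceeds v t (of_rat q) \<longrightarrow> of_rat q < norm x \<longrightarrow> v x \<le> t"
      by (cases "essentially_exceeds v t (of_rat q)") (auto simp: essentially_exceeds_def)
  qed
  have below: "AE x in lborel. \<forall>q::rat. essentially_exceeds v t (of_rat q) \<longrightarrow> norm x \<le> of_rat q \<longrightarrow> t < v x"
    unfolding AE_all_countable
  proof
    fix q :: rat
    show "AE x in lborel. essentially_exceeds v t (of_rat q) \<longrightarrow> norm x \<le> of_rat q \<longrightarrow> t < v x"
    proof (cases "essentially_exceeds v t (of_rat q)")
      case True
      have "\<exists>y. of_rat q < norm y \<and> t < v y \<and> (AE x in lborel. norm x < norm y \<longrightarrow> v y \<le> v x)"
      proof (rule ccontr)
        assume none: "\<not> ?thesis"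
        have "AE y in lborel. of_rat q < norm y \<longrightarrow> v y \<le> t"
          using dec
        proof eventually_elim
          case (elim y)
          with none show ?case by (meson not_less)
        qed
        with True show False by (simp add: essentially_exceeds_def)
      qed
      then obtain y where y: "of_rat q < norm y" "t < v y"
        and below_y: "AE x in lborel. norm x < norm y \<longrightarrow> v y \<le> v x" by blast
      from below_y show ?thesis by eventually_elim (use y in auto)
    qed simp
  qed
  show ?thesis using above below AE_norm_neq[of "Inf A"]
  proof eventually_elim
    case (elim x)
    have bdd: "bdd_below A" by (auto simp: A_def bdd_below_def)
    show ?case
    proof
      assume "t < v x"
      show "essentially_exceeds v t (norm x)"
      proof (rule ccontr)
        assume "\<not> essentially_exceeds v t (norm x)"
        then have xA: "norm x \<in> A" by (simp add: A_def)
        then have "Inf A \<le> norm x" by (rule cInf_lower[OF _ bdd])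
        with elim(3) have "Inf A < norm x" by simp
        then obtain a where "a \<in> A" "a < norm x" using xA cInf_less_iff[OF _ bdd] by blast
        then obtain q :: rat where q: "a < of_rat q" "of_rat q < norm x" using of_rat_dense by blast
        have "\<not> essentially_exceeds v t (of_rat q)"
          using \<open>a \<in> A\<close> q(1) essentially_exceeds_antimono[of v t "of_rat q" a] by (auto simp: A_def)
        with elim(1) q(2) \<open>t < v x\<close> show False by force
      qed
    next
      assume ex: "essentially_exceeds v t (norm x)"
      show "t < v x"
      proof (rule ccontr)
        assume "\<not> t < v x"
        have beyond: "r \<in> A" if r: "norm x < r" for r
        proof -
          obtain q :: rat where q: "norm x < of_rat q" "of_rat q < r" using of_rat_dense[OF r] by blast
          have "\<not> essentially_exceeds v t (of_rat q)" using elim(2) q(1) \<open>\<not> t < v x\<close> by force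
          then have "\<not> essentially_exceeds v t r"
            using essentially_exceeds_antimono[of v t r "of_rat q"] q(2) by auto
          moreover have "0 \<le> r" using that norm_ge_zero[of x] by linarith
          ultimately show ?thesis by (simp add: A_def)
        qed
        have "norm x \<le> a" if "a \<in> A" for a
        proof (rule ccontr)
          assume "\<not> norm x \<le> a"
          then show False using essentially_exceeds_antimono[OF ex, of a] that by (auto simp: A_def)
        qed
        moreover have "norm x + 1 \<in> A" by (rule beyond) simp
        ultimately have "norm x \<le> Inf A" by (intro cInf_greatest) auto
        with elim(3) have "norm x < Inf A" by simp
        \<comment> \<open>Every radius beyond \<open>|x|\<close> lies in \<open>A\<close>, which leaves no room below \<open>Inf A\<close>.\<close>
        then obtain r where "norm x < r" "r < Inf A" using dense by blast
        with beyond[of r] cInf_lower[OF _ bdd, of r] show False by auto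
      qed
    qed
  qed
qed

text \<open>Off a null set, \<open>v(x)\<close> is the supremum of the rational levels whose superlevel set contains \<open>x\<close>. Each of
these sets agrees almost everywhere with a ball, and replacing it by that ball gives a function of
\<open>|x|\<close> that is decreasing everywhere outside the origin. At the origin the supremum can be infinite, so
the value \<open>0\<close> is assigned there.\<close>

lemma AE_eq_symmetric_decreasing:
  fixes v :: "'a::euclidean_space \<Rightarrow> real"
  assumes nonneg: "\<And>x. 0 \<le> v x"
    and dec: "AE y in lborel. AE x in lborel. norm x < norm y \<longrightarrow> v y \<le> v x"
  obtains g where "symmetric_decreasing g" "AE x in lborel. v x = g x"
proof -
  define L where "L r = insert 0 {real_of_rat q | q::rat. 0 \<le> q \<and> essentially_exceeds v (of_rat q) r}" for r
  define g where "g x = (if x = 0 then 0 else Sup (L (norm x)))" for x :: 'a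
  have "AE x in lborel. \<forall>q::rat. of_rat q < v x \<longleftrightarrow> essentially_exceeds v (of_rat q) (norm x)"
    unfolding AE_all_countable using superlevel_set_ball[OF dec] by blast
  then have L_eq: "AE x in lborel. L (norm x) = insert 0 {real_of_rat q | q::rat. 0 \<le> q \<and> of_rat q < v x}"
    by eventually_elim (simp add: L_def)
  have bdd: "bdd_above (L r)" if r: "r > 0" for r
  proof -
    from L_eq have "AE x in lborel. norm x < r \<longrightarrow> L (norm x) = insert 0 {real_of_rat q | q::rat. 0 \<le> q \<and> of_rat q < v x}"
      by eventually_elim simp
    from this r obtain x where x: "norm x < r" "L (norm x) = insert 0 {real_of_rat q | q::rat. 0 \<le> q \<and> of_rat q < v x}"
      by (rule AE_obtains_in_ball)
    have "L r \<subseteq> L (norm x)"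
      using x(1) essentially_exceeds_antimono[of v _ r "norm x"] by (auto simp: L_def)
    moreover have "bdd_above (L (norm x))"
      unfolding x(2) by (rule bdd_aboveI[of _ "v x"]) (auto simp: nonneg)
    ultimately show ?thesis by (rule bdd_above_mono[rotated])
  qed
  have "symmetric_decreasing g"
    unfolding symmetric_decreasing_def
  proof (intro conjI allI impI)
    show "0 \<le> g x" for x
    proof (cases "x = 0")
      case False
      then have "0 \<le> Sup (L (norm x))"
        by (intro cSup_upper bdd) (simp_all add: L_def)
      with False show ?thesis by (simp add: g_def)
    qed (simp add: g_def)
    show "g x = g y" if "norm x = norm y" for x y
      using that by (auto simp: g_def)
    show "g y \<le> g x" if "x \<noteq> 0 \<and> norm x \<le> norm y" for x y
    proof -
      from that have "y \<noteq> 0" by auto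
      moreover have "L (norm y) \<subseteq> L (norm x)"
        using that essentially_exceeds_antimono[of v _ "norm y" "norm x"] by (auto simp: L_def)
      then have "Sup (L (norm y)) \<le> Sup (L (norm x))"
        using that bdd[of "norm x"] by (intro cSup_subset_mono) (auto simp: L_def)
      ultimately show ?thesis using that by (simp add: g_def)
    qed
  qed
  moreover have "AE x in lborel. v x = g x"
    using L_eq AE_lborel_singleton[of "0::'a"]
  proof eventually_elim
    case (elim x)
    have "Sup (insert 0 {real_of_rat q | q::rat. 0 \<le> q \<and> of_rat q < v x}) = v x"
    proof (rule cSup_eq_non_empty)
      fix b assume ub: "\<And>a. a \<in> insert 0 {real_of_rat q | q::rat. 0 \<le> q \<and> of_rat q < v x} \<Longrightarrow> a \<le> b"
      show "v x \<le> b"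
      proof (rule ccontr)
        assume "\<not> v x \<le> b"
        then obtain q :: rat where q: "b < of_rat q" "of_rat q < v x" using of_rat_dense[of b "v x"] by auto
        have "0 \<le> b" using ub by blast
        with q(1) have "0 \<le> (of_rat q :: real)" by linarith
        then have "0 \<le> q" by simp
        with q(2) have "of_rat q \<le> b" by (intro ub) blast
        with q(1) show False by simp
      qed
    qed (auto simp: nonneg)
    with elim show ?case by (simp add: g_def)
  qed
  ultimately show ?thesis by (rule that)
qed

text \<open>A negative and a positive value at two generic points would force almost every point of a small ball
around the origin to carry both signs.\<close>

lemma AE_constant_sign:
  fixes u :: "'a::euclidean_space \<Rightarrow> real"
  assumes dom: "AE y in lborel. AE x in lborel. norm x < norm y \<longrightarrow> \<bar>u x - u y\<bar> + \<bar>u y\<bar> = \<bar>u x\<bar>"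
  shows "(AE x in lborel. 0 \<le> u x) \<or> (AE x in lborel. u x \<le> 0)"
proof (rule ccontr)
  let ?P = "\<lambda>y. AE x in lborel. norm x < norm y \<longrightarrow> \<bar>u x - u y\<bar> + \<bar>u y\<bar> = \<bar>u x\<bar>"
  assume neg: "\<not> ?thesis"
  have good: "AE y in lborel. ?P y \<and> y \<noteq> 0"
    using dom AE_lborel_singleton[of "0::'a"] by eventually_elim blast
  \<comment> \<open>Generic points with values of either sign.\<close>
  have "\<exists>y. ?P y \<and> y \<noteq> 0 \<and> u y < 0"
  proof (rule ccontr)
    assume none: "\<not> ?thesis"
    have "AE y in lborel. 0 \<le> u y"
      using good
    proof eventually_elim
      case (elim y)
      with none show ?case by (meson not_less)
    qed
    with neg show False by blast
  qed
  then obtain y where y: "?P y" "y \<noteq> 0" "u y < 0" by blast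
  have "\<exists>z. ?P z \<and> z \<noteq> 0 \<and> u z > 0"
  proof (rule ccontr)
    assume none: "\<not> ?thesis"
    have "AE y in lborel. u y \<le> 0"
      using good
    proof eventually_elim
      case (elim y)
      with none show ?case by (meson not_less)
    qed
    with neg show False by blast
  qed
  then obtain z where z: "?P z" "z \<noteq> 0" "u z > 0" by blast
  have "AE x in lborel. norm (x::'a) < min (norm y) (norm z) \<longrightarrow> False"
    using y(1) z(1)
  proof eventually_elim
    case (elim x)
    with y(3) z(3) show ?case by linarith
  qed
  moreover have "0 < min (norm y) (norm z)" using y(2) z(2) by simp
  ultimately show False by (rule AE_obtains_in_ball)
qed

theorem slack_energy_zero_iff_proportional:
  fixes u :: "'a::euclidean_space \<Rightarrow> real"
  assumes u: "u \<in> borel_measurable borel"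
  shows "ordered_energy s 1 (slack u) = 0 \<longleftrightarrow>
    (\<exists>c g. symmetric_decreasing g \<and> (AE x in lborel. u x = c * g x))"
  unfolding slack_energy_zero_iff[OF u]
proof
  assume dom: "AE y in lborel. AE x in lborel. norm x < norm y \<longrightarrow> \<bar>u x - u y\<bar> + \<bar>u y\<bar> = \<bar>u x\<bar>"
  have "AE y in lborel. AE x in lborel. norm x < norm y \<longrightarrow> \<bar>u y\<bar> \<le> \<bar>u x\<bar>"
    using dom
  proof eventually_elim
    case (elim y)
    then show ?case by eventually_elim linarith
  qed
  then obtain g where g: "symmetric_decreasing g" "AE x in lborel. \<bar>u x\<bar> = g x"
    using AE_eq_symmetric_decreasing[of "\<lambda>x. \<bar>u x\<bar>"] by auto
  from AE_constant_sign[OF dom] show "\<exists>c g. symmetric_decreasing g \<and> (AE x in lborel. u x = c * g x)"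
  proof
    assume "AE x in lborel. 0 \<le> u x"
    with g(2) have "AE x in lborel. u x = 1 * g x" by eventually_elim simp
    with g(1) show ?thesis by blast
  next
    assume "AE x in lborel. u x \<le> 0"
    with g(2) have "AE x in lborel. u x = (-1) * g x" by eventually_elim simp
    with g(1) show ?thesis by blast
  qed
next
  assume "\<exists>c g. symmetric_decreasing g \<and> (AE x in lborel. u x = c * g x)"
  then obtain c g where g: "symmetric_decreasing g" and ae: "AE x in lborel. u x = c * g x" by blast
  from ae show "AE y in lborel. AE x in lborel. norm x < norm y \<longrightarrow> \<bar>u x - u y\<bar> + \<bar>u y\<bar> = \<bar>u x\<bar>"
  proof eventually_elim
    case (elim y)
    show ?case using ae AE_lborel_singleton[of "0::'a"]
    proof eventually_elim
      case (elim x)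
      show ?case
      proof
        assume "norm x < norm y"
        then have "norm x \<le> norm y" by simp
        with elim(2) g have "g y \<le> g x" "0 \<le> g y" "0 \<le> g x"
          unfolding symmetric_decreasing_def by blast+
        then have "\<bar>c * g x - c * g y\<bar> = \<bar>c\<bar> * (g x - g y)" "\<bar>c * g y\<bar> = \<bar>c\<bar> * g y" "\<bar>c * g x\<bar> = \<bar>c\<bar> * g x"
          by (auto simp: abs_mult right_diff_distrib[symmetric])
        then show "\<bar>u x - u y\<bar> + \<bar>u y\<bar> = \<bar>u x\<bar>"
          by (simp add: elim \<open>u y = c * g y\<close> algebra_simps)
      qed
    qed
  qed
qed

section \<open>Smooth plateaus and the Hardy constant of the punctured space\<close>

text \<open>The family \<open>t\<^bsup>-j\<^esup> exp(-1/t)\<close>, extended by \<open>0\<close> to \<open>t \<le> 0\<close>. Its linear span is closed under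
differentiation, so smoothness of all members can be proved by one induction.\<close>

definition flat :: "nat \<Rightarrow> real \<Rightarrow> real" where
  "flat j t = (if t \<le> 0 then 0 else inverse t ^ j * exp (- inverse t))"

lemma flat_tendsto_0: "(flat j \<longlongrightarrow> 0) (at 0)"
proof (rule filterlim_split_at)
  have "\<forall>\<^sub>F t in at_left 0. flat j t = 0"
    by (auto simp: eventually_at_filter flat_def)
  then show "(flat j \<longlongrightarrow> 0) (at_left 0)" by (rule tendsto_eventually)
  have "((\<lambda>t::real. inverse t ^ j / exp (inverse t)) \<longlongrightarrow> 0) (at_right 0)"
    by (rule filterlim_compose[OF tendsto_power_div_exp_0 filterlim_inverse_at_top_right])
  moreover have "\<forall>\<^sub>F t in at_right (0::real). inverse t ^ j / exp (inverse t) = flat j t"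
    by (auto simp: eventually_at_filter flat_def exp_minus divide_inverse)
  ultimately show "(flat j \<longlongrightarrow> 0) (at_right 0)" by (rule Lim_transform_eventually)
qed

lemma flat_has_derivative:
  "(flat j has_real_derivative flat (j + 2) t - real j * flat (j + 1) t) (at t)"
proof -
  consider "t > 0" | "t < 0" | "t = 0" by linarith
  then show ?thesis
  proof cases
    case 1
    have "((\<lambda>t. inverse t ^ j * exp (- inverse t)) has_real_derivative flat (j + 2) t - real j * flat (j + 1) t) (at t)"
    proof -
      have "((\<lambda>t. inverse t ^ j * exp (- inverse t)) has_real_derivative
          real j * inverse t ^ (j - 1) * (- (inverse t ^ 2)) * exp (- inverse t)
          + exp (- inverse t) * inverse t ^ 2 * inverse t ^ j) (at t)"
        using 1 by (auto intro!: derivative_eq_intros simp: power2_eq_square)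
      moreover have "real j * inverse t ^ (j - 1) * (- (inverse t ^ 2)) * exp (- inverse t)
          + exp (- inverse t) * inverse t ^ 2 * inverse t ^ j = flat (j + 2) t - real j * flat (j + 1) t"
        using 1 by (cases j) (simp_all add: flat_def power2_eq_square algebra_simps)
      ultimately show ?thesis by simp
    qed
    moreover have "\<forall>\<^sub>F x in nhds t. inverse x ^ j * exp (- inverse x) = flat j x"
      by (rule eventually_mono[OF eventually_nhds_in_open[of "{0<..}" t]]) (use 1 in \<open>auto simp: flat_def\<close>)
    ultimately show ?thesis by (simp only: DERIV_cong_ev[OF refl _ refl])
  next
    case 2
    have "\<forall>\<^sub>F x in nhds t. 0 = flat j x"
      by (rule eventually_mono[OF eventually_nhds_in_open[of "{..<0}" t]]) (use 2 in \<open>auto simp: flat_def\<close>)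
    then have "(flat j has_real_derivative 0) (at t)"
      using DERIV_cong_ev[OF refl, of "\<lambda>x. 0" "flat j" t 0 0] by simp
    with 2 show ?thesis by (simp add: flat_def)
  next
    case 3
    have "\<forall>\<^sub>F h in at 0. flat (j + 1) h = (flat j (0 + h) - flat j 0) / h"
      by (auto simp: eventually_at_filter flat_def divide_inverse)
    from Lim_transform_eventually[OF flat_tendsto_0 this]
    have "(flat j has_real_derivative 0) (at 0)" by (simp add: DERIV_def)
    with 3 show ?thesis by (simp add: flat_def)
  qed
qed

lemma flat_continuous: "continuous_on UNIV (flat j)"
  by (intro continuous_at_imp_continuous_on ballI DERIV_isCont[OF flat_has_derivative])

lemma flat_0_mono: "t \<le> t' \<Longrightarrow> flat 0 t \<le> flat 0 t'"
  by (auto simp: flat_def)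

lemma flat_0_nonneg: "0 \<le> flat 0 t"
  by (simp add: flat_def)

lemma Ck_SucI:
  assumes "\<And>x. (f has_derivative f' x) (at x)" and "\<And>b. b \<in> Basis \<Longrightarrow> Ck k (\<lambda>x. f' x b)"
  shows "Ck (Suc k) f"
proof -
  have "frechet_derivative f (at x) = f' x" for x
    using frechet_derivative_at[OF assms(1)] by simp
  moreover have "f differentiable_on UNIV"
    using assms(1) by (auto simp: differentiable_on_def differentiable_def)
  ultimately show ?thesis using assms(2) by simp
qed

lemma Ck_Suc_has_derivative:
  assumes "Ck (Suc k) f"
  shows "(f has_derivative frechet_derivative f (at x)) (at x)"
  using assms by (simp add: differentiable_on_def frechet_derivative_works[symmetric])

lemma Ck_Suc_imp_Ck: "Ck (Suc k) f \<Longrightarrow> Ck k f"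
proof (induction k arbitrary: f)
  case 0
  then show ?case by (auto intro: differentiable_imp_continuous_on)
next
  case (Suc k)
  then have "Ck k (\<lambda>x. frechet_derivative f (at x) b)" if "b \<in> Basis" for b
    using that by (intro Suc.IH) (simp only: Ck.simps(2)[of "Suc k" f])
  with Suc.prems show ?case by simp
qed

lemma Ck_const: "Ck k (\<lambda>x. c)"
proof (induction k arbitrary: c)
  case (Suc k)
  show ?case by (rule Ck_SucI[where f'="\<lambda>x h. 0"]) (auto intro: Suc)
qed simp

lemma Ck_add: "Ck k f \<Longrightarrow> Ck k g \<Longrightarrow> Ck k (\<lambda>x. f x + g x)"
proof (induction k arbitrary: f g)
  case 0
  then show ?case by (simp add: continuous_on_add)
next
  case (Suc k)
  show ?case
  proof (rule Ck_SucI)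
    show "((\<lambda>x. f x + g x) has_derivative (\<lambda>h. frechet_derivative f (at x) h + frechet_derivative g (at x) h)) (at x)" for x
      using Suc.prems by (intro has_derivative_add Ck_Suc_has_derivative)
    show "Ck k (\<lambda>x. frechet_derivative f (at x) b + frechet_derivative g (at x) b)" if "b \<in> Basis" for b
      using Suc.prems that by (intro Suc.IH) auto
  qed
qed

lemma Ck_mult: "Ck k f \<Longrightarrow> Ck k g \<Longrightarrow> Ck k (\<lambda>x. f x * g x)"
proof (induction k arbitrary: f g)
  case 0
  then show ?case by (simp add: continuous_on_mult)
next
  case (Suc k)
  show ?case
  proof (rule Ck_SucI)
    show "((\<lambda>x. f x * g x) has_derivative (\<lambda>h. f x * frechet_derivative g (at x) h + frechet_derivative f (at x) h * g x)) (at x)" for x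
      using Suc.prems by (intro has_derivative_mult Ck_Suc_has_derivative)
    show "Ck k (\<lambda>x. f x * frechet_derivative g (at x) b + frechet_derivative f (at x) b * g x)" if "b \<in> Basis" for b
      using Suc.prems that by (intro Ck_add Suc.IH Ck_Suc_imp_Ck[of k f] Ck_Suc_imp_Ck[of k g]) auto
  qed
qed

text \<open>All members of the family are treated at once, since the derivative of one involves the next two.\<close>

lemma Ck_flat_compose: "Ck k g \<Longrightarrow> Ck k (\<lambda>x. flat j (g x))"
proof (induction k arbitrary: j)
  case 0
  then show ?case by (auto intro: continuous_on_compose2[OF flat_continuous])
next
  case (Suc k)
  show ?case
  proof (rule Ck_SucI)
    show "((\<lambda>x. flat j (g x)) has_derivative (\<lambda>h. frechet_derivative g (at x) h * (flat (j + 2) (g x) + (- real j) * flat (j + 1) (g x)))) (at x)" for x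
      using DERIV_compose_FDERIV[OF flat_has_derivative Ck_Suc_has_derivative[OF Suc.prems]] by simp
    show "Ck k (\<lambda>x. frechet_derivative g (at x) b * (flat (j + 2) (g x) + (- real j) * flat (j + 1) (g x)))" if "b \<in> Basis" for b
    proof -
      have "Ck k g" by (rule Ck_Suc_imp_Ck[OF Suc.prems])
      moreover have "Ck k (\<lambda>x. frechet_derivative g (at x) b)"
        using Suc.prems that by simp
      ultimately show ?thesis by (intro Ck_mult Ck_add Ck_const Suc.IH)
    qed
  qed
qed

lemma Ck_inner_const: "Ck k (\<lambda>x. x \<bullet> c)"
proof (cases k)
  case (Suc i)
  show ?thesis unfolding Suc
    by (rule Ck_SucI[where f'="\<lambda>x h. h \<bullet> c"]) (auto intro!: derivative_eq_intros Ck_const)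
qed (auto intro!: continuous_intros)

lemma Ck_inner_self: "Ck k (\<lambda>x::'a::euclidean_space. x \<bullet> x)"
proof (cases k)
  case (Suc i)
  show ?thesis unfolding Suc
  proof (rule Ck_SucI)
    show "((\<lambda>x. x \<bullet> x) has_derivative (\<lambda>h. 2 * (h \<bullet> x))) (at x)" for x :: 'a
      by (auto intro!: derivative_eq_intros simp: inner_commute)
    show "Ck i (\<lambda>x. 2 * (b \<bullet> x))" for b :: 'a
      unfolding inner_commute[of b] by (intro Ck_mult Ck_const Ck_inner_const)
  qed
qed (auto intro!: continuous_intros)

text \<open>The inner function vanishes on \<open>c |x| \<le> 1\<close> and increases with \<open>|x|\<close>; once it exceeds \<open>1/2\<close> the outer
one vanishes. So the composition is constant near the origin, decreasing in \<open>|x|\<close>, and zero for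
\<open>c |x| \<ge> 2\<close>.\<close>

definition plateau :: "real \<Rightarrow> 'a::euclidean_space \<Rightarrow> real" where
  "plateau c x = flat 0 (1 / 2 - flat 0 (c\<^sup>2 * (x \<bullet> x) - 1))"

lemma Ck_plateau: "Ck k (plateau c)"
proof -
  have "Ck k (\<lambda>x::'a. flat 0 (1 / 2 + (- 1) * flat 0 (c\<^sup>2 * (x \<bullet> x) + (- 1))))"
    by (intro Ck_flat_compose Ck_add Ck_mult Ck_const Ck_inner_self)
  then show ?thesis by (simp add: plateau_def[abs_def])
qed

lemma plateau_measurable [measurable]: "plateau c \<in> borel_measurable borel"
  using Ck_plateau[of 0 c] by (auto intro: borel_measurable_continuous_onI)

lemma plateau_scale: "plateau c x = plateau 1 (c *\<^sub>R x)"
  by (simp add: plateau_def power2_eq_square mult.assoc)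

lemma plateau_nonneg: "0 \<le> plateau c x"
  by (simp add: plateau_def flat_0_nonneg)

lemma plateau_le_1: "plateau c x \<le> 1"
  by (simp add: plateau_def flat_def)

lemma plateau_const: "norm (c *\<^sub>R x) \<le> 1 \<Longrightarrow> plateau c x = flat 0 (1 / 2)"
proof -
  assume "norm (c *\<^sub>R x) \<le> 1"
  then have "(norm (c *\<^sub>R x))\<^sup>2 \<le> 1" by (simp add: power_le_one)
  then have "c\<^sup>2 * (x \<bullet> x) - 1 \<le> 0" by (simp add: power_mult_distrib power2_norm_eq_inner)
  then have "flat 0 (c\<^sup>2 * (x \<bullet> x) - 1) = 0" unfolding flat_def by simp
  then show ?thesis by (simp add: plateau_def)
qed

lemma plateau_eq_0: "2 \<le> norm (c *\<^sub>R x) \<Longrightarrow> plateau c x = 0"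
proof -
  assume "2 \<le> norm (c *\<^sub>R x)"
  then have "2\<^sup>2 \<le> (norm (c *\<^sub>R x))\<^sup>2" by (intro power_mono) auto
  then have "2 \<le> c\<^sup>2 * (x \<bullet> x) - 1" by (simp add: power_mult_distrib power2_norm_eq_inner)
  then have "flat 0 2 \<le> flat 0 (c\<^sup>2 * (x \<bullet> x) - 1)" by (rule flat_0_mono)
  moreover have "1 / 2 \<le> flat 0 2" using exp_ge_add_one_self[of "- (1 / 2)"] by (simp add: flat_def)
  ultimately show ?thesis by (simp add: plateau_def flat_def[of 0 "1 / 2 - _"])
qed

lemma symmetric_decreasing_plateau: "symmetric_decreasing (plateau c)"
  unfolding symmetric_decreasing_def
proof (intro conjI allI impI)
  show "plateau c x = plateau c y" if "norm x = norm y" for x y :: 'a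
    using that by (simp add: plateau_def power2_norm_eq_inner[symmetric])
  show "plateau c y \<le> plateau c x" if "x \<noteq> 0 \<and> norm x \<le> norm y" for x y :: 'a
  proof -
    have "x \<bullet> x \<le> y \<bullet> y" using that by (simp add: norm_le)
    then have "c\<^sup>2 * (x \<bullet> x) - 1 \<le> c\<^sup>2 * (y \<bullet> y) - 1" by (simp add: mult_left_mono)
    then have "flat 0 (c\<^sup>2 * (x \<bullet> x) - 1) \<le> flat 0 (c\<^sup>2 * (y \<bullet> y) - 1)" by (rule flat_0_mono)
    then show ?thesis unfolding plateau_def by (intro flat_0_mono) simp
  qed
qed (rule plateau_nonneg)

lemma hardy_plateau_finite:
  assumes "0 < s" "s < 1"
  shows "hardy s (plateau 1 :: 'a::euclidean_space \<Rightarrow> real) < \<infinity>"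
proof (rule hardy_finite_bounded[OF assms, where E="cball 0 2" and M=1])
  show "\<bar>plateau 1 x\<bar> \<le> 1" for x :: 'a
    using plateau_nonneg[of 1 x] plateau_le_1[of 1 x] by simp
  show "plateau 1 x = 0" if "x \<notin> cball 0 2" for x :: 'a
    using that by (intro plateau_eq_0) simp
qed (simp_all add: emeasure_cball)

lemma hardy_plateau_pos: "0 < hardy s (plateau 1 :: 'a::euclidean_space \<Rightarrow> real)"
proof (rule ccontr)
  assume "\<not> ?thesis"
  then have "hardy s (plateau 1 :: 'a \<Rightarrow> real) = 0" by simp
  then have "AE x in lborel. ennreal (\<bar>plateau 1 (x::'a)\<bar> * norm x powr (- s)) = 0"
    unfolding hardy_def by (subst (asm) nn_integral_0_iff_AE) measurable
  then have "AE x in lborel. norm (x::'a) < 1 \<longrightarrow> \<bar>plateau 1 x\<bar> * norm x powr (- s) = 0"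
  proof eventually_elim
    case (elim x)
    have "0 \<le> \<bar>plateau 1 x\<bar> * norm x powr (- s)" by simp
    with elim show ?case by (simp only: ennreal_eq_0_iff) (blast intro: antisym)
  qed
  moreover have "(0::real) < 1" by simp
  ultimately obtain x :: 'a where x: "norm x < 1" "x \<noteq> 0" "\<bar>plateau 1 x\<bar> * norm x powr (- s) = 0"
    by (rule AE_obtains_in_ball)
  moreover have "plateau 1 x = flat 0 (1 / 2)" using x(1) by (intro plateau_const) simp
  ultimately show False by (simp add: flat_def)
qed

lemma hardy_dilate:
  fixes f :: "'a::euclidean_space \<Rightarrow> real"
  assumes [measurable]: "f \<in> borel_measurable borel" and c: "c > 0"
  shows "hardy s (\<lambda>x. f (c *\<^sub>R x)) = ennreal (c powr (s - DIM('a))) * hardy s f"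
proof -
  have "hardy s f = ennreal (c ^ DIM('a)) * (\<integral>\<^sup>+ x. ennreal (\<bar>f (c *\<^sub>R x)\<bar> * norm (c *\<^sub>R x) powr (- s)) \<partial>lborel)"
    unfolding hardy_def by (rule nn_integral_lborel_dilate[OF _ c]) measurable
  also have "(\<integral>\<^sup>+ x. ennreal (\<bar>f (c *\<^sub>R x)\<bar> * norm (c *\<^sub>R x) powr (- s)) \<partial>lborel)
      = (\<integral>\<^sup>+ x. ennreal (c powr (- s)) * ennreal (\<bar>f (c *\<^sub>R x)\<bar> * norm x powr (- s)) \<partial>lborel)"
    using c by (intro nn_integral_cong) (simp add: powr_mult ennreal_mult[symmetric] mult_ac)
  also have "\<dots> = ennreal (c powr (- s)) * hardy s (\<lambda>x. f (c *\<^sub>R x))"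
    unfolding hardy_def by (rule nn_integral_cmult) measurable
  finally have "ennreal (c powr (s - DIM('a))) * hardy s f
      = ennreal (c powr (s - DIM('a)) * (c ^ DIM('a) * c powr (- s))) * hardy s (\<lambda>x. f (c *\<^sub>R x))"
    using c by (simp add: ennreal_mult mult.assoc)
  also have "c powr (s - DIM('a)) * (c ^ DIM('a) * c powr (- s)) = 1"
    using c by (simp add: powr_realpow[symmetric] powr_add[symmetric])
  finally show ?thesis by simp
qed

lemma hardy_triangle:
  fixes f g :: "'a::euclidean_space \<Rightarrow> real"
  assumes [measurable]: "f \<in> borel_measurable borel" "g \<in> borel_measurable borel"
    and "\<And>x. \<bar>w x\<bar> \<le> \<bar>f x\<bar> + \<bar>g x\<bar>"
  shows "hardy s w \<le> hardy s f + hardy s g"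
proof -
  have "hardy s w \<le> (\<integral>\<^sup>+ x. ennreal (\<bar>f x\<bar> * norm x powr (- s)) + ennreal (\<bar>g x\<bar> * norm x powr (- s)) \<partial>lborel)"
    unfolding hardy_def
  proof (intro nn_integral_mono)
    fix x
    have "\<bar>w x\<bar> * norm x powr (- s) \<le> (\<bar>f x\<bar> + \<bar>g x\<bar>) * norm x powr (- s)"
      by (intro mult_right_mono assms) auto
    then show "ennreal (\<bar>w x\<bar> * norm x powr (- s)) \<le> ennreal (\<bar>f x\<bar> * norm x powr (- s)) + ennreal (\<bar>g x\<bar> * norm x powr (- s))"
      by (simp add: ennreal_plus[symmetric] ring_distribs ennreal_leI del: ennreal_plus)
  qed
  also have "\<dots> = hardy s f + hardy s g"
    unfolding hardy_def by (rule nn_integral_add) measurable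
  finally show ?thesis .
qed

lemma energy_diff_le:
  fixes f g :: "'a::euclidean_space \<Rightarrow> real"
  assumes [measurable]: "f \<in> borel_measurable borel" "g \<in> borel_measurable borel"
  shows "energy s (\<lambda>x. f x - g x) \<le> energy s f + energy s g"
proof -
  have "energy s (\<lambda>x. f x - g x) \<le> (\<integral>\<^sup>+ y. (\<integral>\<^sup>+ x. increment f x y * ennreal (kernel s (x - y)) + increment g x y * ennreal (kernel s (x - y)) \<partial>lborel) \<partial>lborel)"
    unfolding energy_def
  proof (intro nn_integral_mono)
    fix x y :: 'a
    have "increment (\<lambda>x. f x - g x) x y \<le> increment f x y + increment g x y"
      by (simp add: ennreal_plus[symmetric] ennreal_leI del: ennreal_plus)
    then show "increment (\<lambda>x. f x - g x) x y * ennreal (kernel s (x - y)) \<le> increment f x y * ennreal (kernel s (x - y)) + increment g x y * ennreal (kernel s (x - y))"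
      by (simp add: ring_distribs[symmetric] mult_right_mono)
  qed
  also have "\<dots> = energy s f + energy s g"
    unfolding energy_def by (simp add: nn_integral_add)
  finally show ?thesis .
qed

lemma energy_scale:
  fixes f :: "'a::euclidean_space \<Rightarrow> real"
  assumes [measurable]: "f \<in> borel_measurable borel" and "k \<ge> 0"
  shows "energy s (\<lambda>x. k * f x) = ennreal k * energy s f"
proof -
  have "increment (\<lambda>x. k * f x) x y = ennreal k * increment f x y" for x y
    using \<open>k \<ge> 0\<close> by (simp add: right_diff_distrib[symmetric] abs_mult ennreal_mult)
  then show ?thesis
    unfolding energy_def by (simp add: mult.assoc nn_integral_cmult)
qed

lemma hardy_scale:
  fixes f :: "'a::euclidean_space \<Rightarrow> real"
  assumes [measurable]: "f \<in> borel_measurable borel" and "k \<ge> 0"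
  shows "hardy s (\<lambda>x. k * f x) = ennreal k * hardy s f"
  unfolding hardy_def using \<open>k \<ge> 0\<close>
  by (simp add: abs_mult mult.assoc ennreal_mult nn_integral_cmult)

lemma energy_symmetric_decreasing:
  fixes u :: "'a::euclidean_space \<Rightarrow> real"
  assumes u: "u \<in> borel_measurable borel" and "symmetric_decreasing u" and "hardy s u < \<infinity>"
    and s: "0 < s" "s < 1"
  shows "energy s u = ennreal (sharp_const s DIM('a)) * hardy s u"
proof -
  have "\<exists>c g. symmetric_decreasing g \<and> (AE x in lborel. u x = c * g x)"
    using assms(2) by (intro exI[of _ 1] exI[of _ u]) simp
  then show ?thesis
    using fractional_hardy_identity[OF u assms(3) s] slack_energy_zero_iff_proportional[OF u, of s] by simp
qed

lemma frontier_punctured: "frontier (UNIV - {0::'a::euclidean_space}) = {0}"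
proof -
  have "frontier (- {0::'a}) = frontier {0}" by (rule frontier_complement)
  then show ?thesis by (simp add: frontier_def Compl_eq_Diff_UNIV)
qed

lemma punctured_hardy_integral:
  fixes u :: "'a::euclidean_space \<Rightarrow> real"
  shows "(\<integral>\<^sup>+ x\<in>UNIV - {0}. ennreal (\<bar>u x\<bar> / boundary_dist (UNIV - {0}) x powr s) \<partial>lebesgue) = hardy s u"
proof -
  have "(\<integral>\<^sup>+ x\<in>UNIV - {0}. ennreal (\<bar>u x\<bar> / boundary_dist (UNIV - {0}) x powr s) \<partial>lebesgue) = hardy_integral s u"
    unfolding hardy_integral_def boundary_dist_def frontier_punctured
    by (intro nn_integral_cong) (auto simp: infdist_singleton dist_norm split: split_indicator)
  also have "\<dots> = hardy s u" by (rule hardy_integral_eq_hardy) simp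
  finally show ?thesis .
qed

lemma hardy_const_punctured_ge:
  assumes s: "0 < s" "s < 1"
  shows "ennreal (sharp_const s DIM('a)) \<le> hardy_const s (UNIV - {0 :: 'a::euclidean_space})"
  unfolding hardy_const_def punctured_hardy_integral
proof (rule Inf_greatest)
  fix E assume "E \<in> {gagliardo s u | u. u \<in> test_functions (UNIV - {0 :: 'a}) \<and> hardy s u = 1}"
  then obtain u where u: "u \<in> test_functions (UNIV - {0 :: 'a})" "hardy s u = 1" "E = gagliardo s u" by blast
  have "Ck 0 u" using u(1) unfolding test_functions_def smooth_def by blast
  then have "u \<in> borel_measurable borel" by (auto intro: borel_measurable_continuous_onI)
  from fractional_hardy_identity[OF this _ s] u(2,3) gagliardo_eq_energy[of u u s]
  show "ennreal (sharp_const s DIM('a)) \<le> E" by simp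
qed

text \<open>The two plateaus agree on \<open>c |x| \<le> 1\<close> and both vanish for \<open>|x| \<ge> 2\<close>.\<close>

lemma punctured_plateau_test_function:
  fixes k :: real
  assumes c: "c \<ge> 1"
  shows "(\<lambda>x. k * (plateau 1 x - plateau c x)) \<in> test_functions (UNIV - {0 :: 'a::euclidean_space})"
proof -
  let ?w = "\<lambda>x::'a. k * (plateau 1 x - plateau c x)"
  have "Ck i (\<lambda>x::'a. k * (plateau 1 x + (- 1) * plateau c x))" for i
    by (intro Ck_mult Ck_add Ck_const Ck_plateau)
  then have "smooth ?w" by (simp add: smooth_def)
  have supp: "{x. ?w x \<noteq> 0} \<subseteq> cball 0 2 - ball 0 (1 / c)"
  proof
    fix x assume x: "x \<in> {x. ?w x \<noteq> 0}"
    have "norm x \<le> 2"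
    proof (rule ccontr)
      assume "\<not> norm x \<le> 2"
      moreover have "1 * norm x \<le> c * norm x" using c by (intro mult_right_mono) auto
      ultimately have "plateau 1 x = 0" "plateau c x = 0"
        using c by (auto intro!: plateau_eq_0)
      with x show False by simp
    qed
    moreover have "\<not> norm x < 1 / c"
    proof
      assume "norm x < 1 / c"
      then have "c * norm x \<le> 1" using c by (simp add: field_simps)
      moreover have "1 * norm x \<le> c * norm x" using c by (intro mult_right_mono) auto
      ultimately have "plateau 1 x = flat 0 (1 / 2)" "plateau c x = flat 0 (1 / 2)"
        using c by (auto intro!: plateau_const)
      with x show False by simp
    qed
    ultimately show "x \<in> cball 0 2 - ball 0 (1 / c)" by simp
  qed
  have "closed (cball (0::'a) 2 - ball 0 (1 / c))" by (intro closed_Diff) auto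
  with supp have cl: "closure {x. ?w x \<noteq> 0} \<subseteq> cball 0 2 - ball 0 (1 / c)" by (rule closure_minimal)
  then have "bounded (closure {x. ?w x \<noteq> 0})"
    by (intro bounded_subset[OF bounded_cball[of 0 2]]) blast
  then have "compact (closure {x. ?w x \<noteq> 0})" by (simp add: compact_eq_bounded_closed)
  moreover have "closure {x. ?w x \<noteq> 0} \<subseteq> UNIV - {0}" using cl c by auto
  ultimately show ?thesis using \<open>smooth ?w\<close> by (simp add: test_functions_def)
qed

text \<open>Both plateaus are equality cases, so for their difference the seminorm is at most \<open>C (1 + d) H\<close> and the
Hardy integral at least \<open>(1 - d) H\<close>, where \<open>H\<close> belongs to the wider plateau and \<open>d = c\<^bsup>s-N\<^esup>\<close>. As
\<open>c\<close> grows, \<open>d\<close> tends to \<open>0\<close>.\<close>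

lemma hardy_const_punctured_le:
  assumes s: "0 < s" "s < 1"
  shows "hardy_const s (UNIV - {0 :: 'a::euclidean_space}) \<le> ennreal (sharp_const s DIM('a))"
proof -
  let ?P = "plateau 1 :: 'a \<Rightarrow> real"
  define K where "K = sharp_const s DIM('a)"
  have K: "K > 0" unfolding K_def using sharp_const_pos[OF s DIM_positive] by simp
  define H where "H = enn2real (hardy s ?P)"
  have H_eq: "hardy s ?P = ennreal H"
    using hardy_plateau_finite[OF s, where 'a='a] by (simp add: H_def less_top)
  have H: "H > 0" using hardy_plateau_pos[of s, where 'a='a] unfolding H_eq by simp
  have bound: "hardy_const s (UNIV - {0 :: 'a}) \<le> ennreal (K * (1 + d) / (1 - d))"
    if c: "c > 1" and d: "d = c powr (s - DIM('a))" for c d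
  proof -
    let ?Q = "plateau c :: 'a \<Rightarrow> real"
    let ?w = "\<lambda>x. ?P x - ?Q x"
    have sn: "s < DIM('a)" using s DIM_positive[where 'a='a] by linarith
    have d01: "0 < d" "d < 1" using c sn by (auto simp: d intro!: powr_less_one)
    have HQ: "hardy s ?Q = ennreal (d * H)"
    proof -
      have "?Q = (\<lambda>x. ?P (c *\<^sub>R x))" by (rule ext) (rule plateau_scale)
      then have "hardy s ?Q = hardy s (\<lambda>x. ?P (c *\<^sub>R x))" by simp
      also have "\<dots> = ennreal d * hardy s ?P" unfolding d using c by (intro hardy_dilate) auto
      finally show ?thesis using d01 H by (simp add: H_eq ennreal_mult)
    qed
    have "energy s ?w \<le> energy s ?P + energy s ?Q" by (rule energy_diff_le) auto
    also have "\<dots> = ennreal K * hardy s ?P + ennreal K * hardy s ?Q"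
      unfolding K_def using s H_eq HQ by (simp add: energy_symmetric_decreasing symmetric_decreasing_plateau)
    also have "\<dots> = ennreal (K * H + K * (d * H))"
      using K H d01 by (simp add: H_eq HQ ennreal_mult[symmetric] ennreal_plus[symmetric] del: ennreal_plus)
    also have "K * H + K * (d * H) = K * (1 + d) * H" by (simp add: algebra_simps)
    finally have E: "energy s ?w \<le> ennreal (K * (1 + d) * H)" .
    have wmeas [measurable]: "?w \<in> borel_measurable borel" by measurable
    have "hardy s ?w \<le> hardy s ?P + hardy s ?Q" by (rule hardy_triangle) auto
    also have "\<dots> < \<infinity>" by (simp add: H_eq HQ)
    finally have fin: "hardy s ?w < \<infinity>" .
    define W where "W = enn2real (hardy s ?w)"
    have W_eq: "hardy s ?w = ennreal W" and W0: "W \<ge> 0" using fin by (simp_all add: W_def less_top)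
    have "hardy s ?P \<le> hardy s ?w + hardy s ?Q" by (rule hardy_triangle) auto
    then have "ennreal H \<le> ennreal (W + d * H)"
      using W0 H d01 by (simp add: H_eq HQ W_eq)
    then have "H \<le> W + d * H"
      using W0 H d01 by (subst (asm) ennreal_le_iff) auto
    then have W: "(1 - d) * H \<le> W" by (simp add: algebra_simps)
    moreover have "0 < (1 - d) * H" using H d01 by simp
    ultimately have Wpos: "W > 0" by linarith
    let ?v = "\<lambda>x. (1 / W) * ?w x"
    have "hardy s ?v = ennreal (1 / W) * hardy s ?w"
      using Wpos by (intro hardy_scale wmeas) simp
    also have "\<dots> = 1" using Wpos by (simp add: W_eq ennreal_mult[symmetric])
    finally have "hardy s ?v = 1" .
    moreover have "?v \<in> test_functions (UNIV - {0})"
      using c by (intro punctured_plateau_test_function) simp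
    ultimately have "hardy_const s (UNIV - {0 :: 'a}) \<le> gagliardo s ?v"
      unfolding hardy_const_def punctured_hardy_integral by (intro Inf_lower) blast
    also have "\<dots> = energy s ?v" by (rule gagliardo_eq_energy) simp
    also have "\<dots> = ennreal (1 / W) * energy s ?w" using Wpos by (intro energy_scale) auto
    also have "\<dots> \<le> ennreal (1 / W) * ennreal (K * (1 + d) * H)" by (intro mult_left_mono E) auto
    also have "\<dots> = ennreal (1 / W * (K * (1 + d) * H))"
      using Wpos K H d01 by (intro ennreal_mult[symmetric]) auto
    also have "\<dots> \<le> ennreal (K * (1 + d) / (1 - d))"
    proof (rule ennreal_leI)
      have "K * (1 + d) * ((1 - d) * H) \<le> K * (1 + d) * W"
        using W K d01 by (intro mult_left_mono) auto
      then show "1 / W * (K * (1 + d) * H) \<le> K * (1 + d) / (1 - d)"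
        using Wpos d01 by (simp add: field_simps)
    qed
    finally show ?thesis .
  qed
  have lim: "((\<lambda>c. ennreal (K * (1 + c powr (s - DIM('a))) / (1 - c powr (s - DIM('a))))) \<longlongrightarrow> ennreal (K * (1 + 0) / (1 - 0))) at_top"
  proof -
    have "s - DIM('a) < 0" using s DIM_positive[where 'a='a] by linarith
    then have "((\<lambda>c. c powr (s - DIM('a))) \<longlongrightarrow> 0) at_top"
      by (intro tendsto_neg_powr filterlim_ident)
    then show ?thesis by (intro tendsto_intros) auto
  qed
  have "hardy_const s (UNIV - {0 :: 'a}) \<le> ennreal (K * (1 + 0) / (1 - 0))"
  proof (rule tendsto_lowerbound[OF lim])
    show "\<forall>\<^sub>F c in at_top. hardy_const s (UNIV - {0 :: 'a})
        \<le> ennreal (K * (1 + c powr (s - DIM('a))) / (1 - c powr (s - DIM('a))))"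
      using eventually_gt_at_top[of 1] by eventually_elim (rule bound, auto)
  qed simp
  then show ?thesis by (simp add: K_def)
qed

theorem hardy_const_punctured:
  assumes s: "0 < s" "s < 1"
  shows "hardy_const s (UNIV - {0 :: 'a::euclidean_space}) = ennreal (sharp_const s DIM('a))"
  by (rule antisym[OF hardy_const_punctured_le[OF s] hardy_const_punctured_ge[OF s]])

section \<open>The sharp fractional Hardy inequality and its equality cases\<close>

lemma plateau_in_homogeneous_W0:
  assumes s: "0 < s" "s < 1"
  shows "(plateau 1 :: 'a::euclidean_space \<Rightarrow> real) \<in> homogeneous_W0 s"
proof -
  let ?P = "plateau 1 :: 'a \<Rightarrow> real"
  define q where "q = real DIM('a) / (real DIM('a) - s)"
  have q: "q > 0" unfolding q_def using s DIM_positive[where 'a='a] by (intro divide_pos_pos) linarith+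
  have "(\<integral>\<^sup>+ x. ennreal (\<bar>?P x\<bar> powr q) \<partial>lborel) \<le> (\<integral>\<^sup>+ x. indicator (cball (0::'a) 2) x \<partial>lborel)"
  proof (rule nn_integral_mono)
    fix x :: 'a
    show "ennreal (\<bar>?P x\<bar> powr q) \<le> indicator (cball 0 2) x"
    proof (cases "norm x \<le> 2")
      case True
      have "\<bar>?P x\<bar> powr q \<le> 1 powr q"
        using plateau_nonneg[of 1 x] plateau_le_1[of 1 x] q by (intro powr_mono2) auto
      with True show ?thesis by simp
    next
      case False
      then have "?P x = 0" by (intro plateau_eq_0) simp
      with q show ?thesis by simp
    qed
  qed
  also have "\<dots> < \<infinity>" by (simp add: emeasure_cball)
  finally have Lq: "(\<integral>\<^sup>+ x. ennreal (\<bar>?P x\<bar> powr q) \<partial>lborel) < \<infinity>" .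
  have "gagliardo s ?P = energy s ?P" by (rule gagliardo_eq_energy) simp
  also have "\<dots> = ennreal (sharp_const s DIM('a)) * hardy s ?P"
    by (intro energy_symmetric_decreasing symmetric_decreasing_plateau hardy_plateau_finite s) measurable
  also have "\<dots> < \<infinity>" using hardy_plateau_finite[OF s, where 'a='a] by (simp add: ennreal_mult_less_top)
  finally have "gagliardo s ?P < \<infinity>" .
  moreover have "?P \<in> borel_measurable lebesgue" by (intro measurable_completion) simp
  ultimately show ?thesis using Lq by (simp add: homogeneous_W0_def nn_integral_completion q_def)
qed

text \<open>Adding the remainder term to a finite multiple of the Hardy integral changes nothing exactly when the
remainder is zero.\<close>

theorem fractional_hardy_homogeneous_W0:
  fixes u :: "'a::euclidean_space \<Rightarrow> real"
  assumes u: "u \<in> homogeneous_W0 s" and s: "0 < s" "s < 1"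
  shows "ennreal (sharp_const s DIM('a)) * hardy_integral s u \<le> gagliardo s u"
    and "gagliardo s u = ennreal (sharp_const s DIM('a)) * hardy_integral s u \<longleftrightarrow>
         proportional_to_symmetric_decreasing u"
proof -
  obtain v where v: "v \<in> borel_measurable borel" and ae: "AE x in lborel. u x = v x" and fin: "hardy s v < \<infinity>"
    using homogeneous_W0_borel[OF assms] .
  have id: "gagliardo s u = ennreal (sharp_const s DIM('a)) * hardy_integral s u + 2 * ordered_energy s 1 (slack v)"
    using fractional_hardy_identity[OF v fin s] by (simp add: gagliardo_eq_energy[OF ae] hardy_integral_eq_hardy[OF ae])
  then show "ennreal (sharp_const s DIM('a)) * hardy_integral s u \<le> gagliardo s u" by simp
  have "ennreal (sharp_const s DIM('a)) * hardy_integral s u < \<infinity>"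
    using fin by (simp add: hardy_integral_eq_hardy[OF ae] ennreal_mult_less_top)
  then have "gagliardo s u = ennreal (sharp_const s DIM('a)) * hardy_integral s u \<longleftrightarrow> ordered_energy s 1 (slack v) = 0"
    unfolding id
    using ennreal_add_left_cancel[of "ennreal (sharp_const s DIM('a)) * hardy_integral s u" "2 * ordered_energy s 1 (slack v)" 0] by auto
  also have "\<dots> \<longleftrightarrow> (\<exists>c g. symmetric_decreasing g \<and> (AE x in lborel. v x = c * g x))"
    by (rule slack_energy_zero_iff_proportional[OF v])
  also have "\<dots> \<longleftrightarrow> proportional_to_symmetric_decreasing u"
  proof -
    have "(AE x in lborel. v x = c * g x) \<longleftrightarrow> (AE x in lborel. u x = c * g x)" for c g
    proof
      assume "AE x in lborel. v x = c * g x"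
      with ae show "AE x in lborel. u x = c * g x" by eventually_elim simp
    next
      assume "AE x in lborel. u x = c * g x"
      with ae show "AE x in lborel. v x = c * g x" by eventually_elim simp
    qed
    then show ?thesis by (simp add: proportional_to_symmetric_decreasing_def AE_completion_iff)
  qed
  finally show "gagliardo s u = ennreal (sharp_const s DIM('a)) * hardy_integral s u \<longleftrightarrow>
         proportional_to_symmetric_decreasing u" .
qed

text \<open>Any equality case with positive finite Hardy integral suffices; the plateau is one.\<close>

theorem sharp_const_optimal:
  assumes s: "0 < s" "s < 1"
    and K: "\<And>u :: 'a::euclidean_space \<Rightarrow> real. u \<in> homogeneous_W0 s \<Longrightarrow> K * hardy_integral s u \<le> gagliardo s u"
  shows "K \<le> ennreal (sharp_const s DIM('a))"
proof -
  let ?P = "plateau 1 :: 'a \<Rightarrow> real"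
  have H: "hardy_integral s ?P = hardy s ?P" and E: "gagliardo s ?P = energy s ?P"
    by (simp_all add: hardy_integral_eq_hardy[of ?P ?P] gagliardo_eq_energy[of ?P ?P])
  have "K * hardy s ?P \<le> ennreal (sharp_const s DIM('a)) * hardy s ?P"
    using K[OF plateau_in_homogeneous_W0[OF s]] hardy_plateau_finite[OF s, where 'a='a]
    by (simp add: H E energy_symmetric_decreasing[OF _ symmetric_decreasing_plateau _ s])
  then have "K * hardy s ?P / hardy s ?P \<le> ennreal (sharp_const s DIM('a)) * hardy s ?P / hardy s ?P"
    by (rule divide_right_mono_ennreal)
  then show ?thesis
    using hardy_plateau_finite[OF s, where 'a='a] hardy_plateau_pos[of s, where 'a='a]
    by (simp add: ennreal_times_divide[symmetric] mult_divide_eq_ennreal)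
qed

theorem corollary1p5:
  fixes s :: real
  assumes "0 < s" and "s < 1"
  defines "h \<equiv> hardy_const s (UNIV - {0 :: real ^ 'n})"
  defines "N \<equiv> real CARD('n)"
  shows "(\<forall>u :: real ^ 'n \<Rightarrow> real. u \<in> homogeneous_W0 s \<longrightarrow>
            gagliardo s u \<ge> h * hardy_integral s u) \<and>
         (\<forall>K. (\<forall>u :: real ^ 'n \<Rightarrow> real. u \<in> homogeneous_W0 s \<longrightarrow>
            gagliardo s u \<ge> K * hardy_integral s u) \<longrightarrow> K \<le> h) \<and>
         h = ennreal (4 / s * (pi powr (N / 2) * Gamma (1 - s) /
               (Gamma ((N - s) / 2) * Gamma (1 - s / 2)))) \<and>
         (\<forall>u :: real ^ 'n \<Rightarrow> real. u \<in> homogeneous_W0 s \<longrightarrow>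
            (gagliardo s u = h * hardy_integral s u \<longleftrightarrow>
             proportional_to_symmetric_decreasing u))"
proof -
  have h: "h = ennreal (sharp_const s DIM(real ^ 'n))"
    unfolding h_def by (rule hardy_const_punctured[OF assms(1,2)])
  show ?thesis
  proof (intro conjI allI impI)
    show "K \<le> h" if "\<forall>u :: real ^ 'n \<Rightarrow> real. u \<in> homogeneous_W0 s \<longrightarrow> K * hardy_integral s u \<le> gagliardo s u" for K
      unfolding h using that by (intro sharp_const_optimal assms(1,2)) blast
    show "h = ennreal (4 / s * (pi powr (N / 2) * Gamma (1 - s) / (Gamma ((N - s) / 2) * Gamma (1 - s / 2))))"
      unfolding h sharp_const_def N_def by simp
    fix u :: "real ^ 'n \<Rightarrow> real" assume u: "u \<in> homogeneous_W0 s"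
    show "h * hardy_integral s u \<le> gagliardo s u"
      unfolding h by (rule fractional_hardy_homogeneous_W0(1)[OF u assms(1,2)])
    show "gagliardo s u = h * hardy_integral s u \<longleftrightarrow> proportional_to_symmetric_decreasing u"
      unfolding h by (rule fractional_hardy_homogeneous_W0(2)[OF u assms(1,2)])
  qed
qed

end
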